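(* Let $H$ be a complex Hilbert space, $D(a)$ a dense subspace of $H$, and $a\colon D(a)\times D(a)\to\mathbf{C}$ a sesquilinear form. Suppose $a$ is sectorial: there are $\theta\in[0,\frac{\pi}{2})$ and $\gamma\in\mathbf{R}$ such that $a(u)-\gamma\|u\|_H^2\in\Sigma_\theta$ for all $u\in D(a)$. (It is not assumed that $a$ is closable.) Then there is a well-defined (single-valued) operator $A$ in $H$ such that for all $x,f\in H$ one has $x\in D(A)$ and $Ax=f$ if and only if there exist $u_1,u_2,\ldots\in D(a)$ such that $(\operatorname{Re}a(u_n))_n$ is bounded, $\lim_{n\to\infty}u_n=x$ in $H$, and $\lim_{n\to\infty}a(u_n,v)=(f,v)_H$ for all $v\in D(a)$. Moreover, $-A$ generates a holomorphic $C_0$-semigroup on the interior of $\Sigma_{\frac{\pi}{2}-\theta}$.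
   Context: Sesquilinear forms and inner products are linear in the first and conjugate-linear in the second variable; $a(u)=a(u,u)$. For $\theta\in[0,\frac\pi2]$, $\Sigma_\theta=\{re^{i\alpha}:r\ge 0,\ |\alpha|\le\theta\}$ is the closed sector. An operator in $H$ is a single-valued linear map $A\colon D(A)\to H$ with $D(A)$ a linear subspace of $H$. *)

theory Defs
  imports "HOL-Analysis.Analysis"
begin

text \<open>
  The class extends \<open>banach\<close>, so completeness, the topology and the norm are those of the library;
  the last axiom says that this norm is the one induced by the inner product.
\<close>

class complex_hilbert_space = banach +
  fixes scaleC :: "complex \<Rightarrow> 'a \<Rightarrow> 'a" (infixr \<open>*\<^sub>C\<close> 75)
    and cinner :: "'a \<Rightarrow> 'a \<Rightarrow> complex"
  assumes scaleC_add_right: "c *\<^sub>C (x + y) = c *\<^sub>C x + c *\<^sub>C y"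
    and scaleC_add_left: "(c + d) *\<^sub>C x = c *\<^sub>C x + d *\<^sub>C x"
    and scaleC_scaleC: "c *\<^sub>C (d *\<^sub>C x) = (c * d) *\<^sub>C x"
    and scaleR_eq_scaleC: "r *\<^sub>R x = complex_of_real r *\<^sub>C x"
    and cinner_add_left: "cinner (x + y) z = cinner x z + cinner y z"
    and cinner_scaleC_left: "cinner (c *\<^sub>C x) y = c * cinner x y"
    and cinner_commute: "cinner x y = cnj (cinner y x)"
    and cinner_self: "cinner x x = complex_of_real ((norm x)\<^sup>2)"

lemma scaleC_one [simp]: "1 *\<^sub>C x = (x :: 'a::complex_hilbert_space)"
  by (metis of_real_1 scaleR_eq_scaleC scaleR_one)

global_interpretation complex_vector:
  vector_space "scaleC :: complex \<Rightarrow> 'a \<Rightarrow> 'a::complex_hilbert_space"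
  by unfold_locales (simp_all add: scaleC_add_right scaleC_add_left scaleC_scaleC)

definition sector :: "real \<Rightarrow> complex set" where
  "sector \<theta> = {rcis r \<alpha> | r \<alpha>. 0 \<le> r \<and> \<bar>\<alpha>\<bar> \<le> \<theta>}"

definition sesquilinear_on ::
  "'h::complex_hilbert_space set \<Rightarrow> ('h \<Rightarrow> 'h \<Rightarrow> complex) \<Rightarrow> bool" where
  "sesquilinear_on V a \<longleftrightarrow>
     (\<forall>u\<in>V. \<forall>v\<in>V. \<forall>w\<in>V. a (u + v) w = a u w + a v w \<and> a w (u + v) = a w u + a w v) \<and>
     (\<forall>c. \<forall>u\<in>V. \<forall>v\<in>V. a (c *\<^sub>C u) v = c * a u v \<and> a u (c *\<^sub>C v) = cnj c * a u v)"

text \<open>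
  An operator in H is given by its domain \<open>D\<close> and a function \<open>A\<close>,
  whose values outside \<open>D\<close> are irrelevant.
\<close>

definition operator_in :: "'h::complex_hilbert_space set \<Rightarrow> ('h \<Rightarrow> 'h) \<Rightarrow> bool" where
  "operator_in D A \<longleftrightarrow> complex_vector.subspace D \<and>
     (\<forall>x\<in>D. \<forall>y\<in>D. A (x + y) = A x + A y) \<and> (\<forall>c. \<forall>x\<in>D. A (c *\<^sub>C x) = c *\<^sub>C A x)"

definition bounded_clinear :: "('h::complex_hilbert_space \<Rightarrow> 'h) \<Rightarrow> bool" where
  "bounded_clinear T \<longleftrightarrow> bounded_linear T \<and> (\<forall>c x. T (c *\<^sub>C x) = c *\<^sub>C T x)"

text \<open>Complex differentiability with respect to the operator norm at every point of \<open>\<Omega>\<close>.\<close>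

definition operator_holomorphic_on ::
  "(complex \<Rightarrow> 'h \<Rightarrow> 'h::complex_hilbert_space) \<Rightarrow> complex set \<Rightarrow> bool" where
  "operator_holomorphic_on T \<Omega> \<longleftrightarrow>
     (\<forall>z\<in>\<Omega>. bounded_clinear (T z)) \<and>
     (\<forall>z\<in>\<Omega>. \<exists>T'. bounded_clinear T' \<and>
        ((\<lambda>w. onorm (\<lambda>x. (1 / (w - z)) *\<^sub>C (T w x - T z x) - T' x)) \<longlongrightarrow> 0) (at z within \<Omega>))"

text \<open>
  Holomorphic semigroup on the open sector of half-angle \<open>\<phi>\<close>, with the usual convention that
  strong continuity at the origin is required in every smaller closed sector. The case
  \<open>\<psi> = 0\<close> says that \<open>T\<close> restricts to a \<open>C\<^sub>0\<close>-semigroup on the half-line.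
\<close>

definition holomorphic_C0_semigroup ::
  "real \<Rightarrow> (complex \<Rightarrow> 'h \<Rightarrow> 'h::complex_hilbert_space) \<Rightarrow> bool" where
  "holomorphic_C0_semigroup \<phi> T \<longleftrightarrow>
     operator_holomorphic_on T (interior (sector \<phi>)) \<and>
     T 0 = id \<and>
     (\<forall>z\<in>insert 0 (interior (sector \<phi>)). \<forall>w\<in>insert 0 (interior (sector \<phi>)).
        T (z + w) = T z \<circ> T w) \<and>
     (\<forall>\<psi> x. 0 \<le> \<psi> \<and> \<psi> < \<phi> \<longrightarrow> ((\<lambda>z. T z x) \<longlongrightarrow> x) (at 0 within sector \<psi>))"

text \<open>
  \<open>B\<close> with domain \<open>D\<close> is the generator of the semigroup \<open>S\<close>: the domain consists of exactly those
  \<open>x\<close> for which the right derivative of \<open>S t x\<close> at \<open>t = 0\<close> exists, and \<open>B x\<close> is its value.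
\<close>

definition is_generator ::
  "'h::complex_hilbert_space set \<Rightarrow> ('h \<Rightarrow> 'h) \<Rightarrow> (real \<Rightarrow> 'h \<Rightarrow> 'h) \<Rightarrow> bool" where
  "is_generator D B S \<longleftrightarrow>
     (\<forall>x y. x \<in> D \<and> B x = y \<longleftrightarrow> ((\<lambda>t. (1 / t) *\<^sub>R (S t x - x)) \<longlongrightarrow> y) (at_right 0))"

definition generates_holomorphic_C0_semigroup ::
  "real \<Rightarrow> 'h::complex_hilbert_space set \<Rightarrow> ('h \<Rightarrow> 'h) \<Rightarrow> bool" where
  "generates_holomorphic_C0_semigroup \<phi> D B \<longleftrightarrow>
     (\<exists>T. holomorphic_C0_semigroup \<phi> T \<and> is_generator D B (\<lambda>t. T (complex_of_real t)))"

end

theory Submission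
  imports Defs "HOL-Complex_Analysis.Complex_Analysis"
begin

text \<open>
  Replace \<open>a\<close> by \<open>a - \<gamma>\<close>, so that \<open>\<gamma> = 0\<close>, and let \<open>z\<close> be in the interior \<open>S\<close> of the sector of
  half-angle \<open>\<pi>/2 - \<theta>\<close>. The form \<open>(u, v) + z a(u, v)\<close> is bounded and coercive for the norm
  \<open>N(u)\<^sup>2 = Re a(u) + \<parallel>u\<parallel>\<^sup>2\<close>. Instead of completing the form domain one solves the Lax-Milgram
  problem approximately inside it, with an error that is small in the dual norm. The
  approximate solutions are Cauchy for \<open>N\<close>, hence converge in \<open>H\<close>, and this shows that \<open>1 + zA\<close> is
  onto with a contractive inverse \<open>J(z)\<close>; approximate solutions of the adjoint problem show that
  \<open>1 + zA\<close> is injective, although the sequences defining \<open>A\<close> are only bounded for \<open>N\<close>.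

  The semigroup is \<open>T(z) x = lim J(z/n)\<^sup>n x\<close>. For commuting contractions \<open>C\<close> and \<open>C'\<close> one has
  \<open>\<parallel>C\<^sup>n x - C'\<^sup>n x\<parallel> \<le> n \<parallel>C x - C' x\<parallel>\<close>; since \<open>J(w) x = x - w A x\<close> up to an error
  \<open>|w|\<^sup>2 \<parallel>A\<^sup>2 x\<parallel>\<close>, this gives locally uniform convergence on the domain of \<open>A\<^sup>2\<close>, then everywhere by
  density, and it also gives the semigroup law.
\<close>

section \<open>Forms\<close>

text \<open>Without closability the completion of the form domain for N need not embed in H: a
  sequence can be N-Cauchy, tend to 0 in H and yet stay away from 0 in N. So it is in doubt whether
  A is single-valued. The approximate solutions u_n of a problem with right-hand side g carry more
  than their limit x in H: testing with u_n itself shows that the form values at (u_n, u_n) tend to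
  (g, x). If x = 0, coercivity then forces u_n to 0 in N, hence g = 0. This is the fact that
  excludes a second value of A, and it also gives density of the domain.

  Coercivity rests on angles: those of z and of a(u) add up to at most pi/2. As S is open, some
  \<epsilon> > 0 can first be subtracted from z, and the part split off controls Re a(u).

  Every J(z) with z in S is a contraction, so Euler's formula serves the whole sector at once, and T
  inherits holomorphy from the powers of J by locally uniform convergence, where the usual
  construction integrates the resolvent over a contour.\<close>

lemma norm_le_of_quadratic_nonneg:
  fixes d :: complex and E n :: real
  assumes "0 \<le> E" and "0 \<le> n"
    and q: "\<And>s. 0 \<le> E\<^sup>2 + 2 * Re (cnj s * d) + (cmod s)\<^sup>2 * n\<^sup>2"
  shows "cmod d \<le> E * n"
proof (cases "d = 0")
  case True
  then show ?thesis using assms by simp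
next
  case False
  have q': "2 * t * cmod d \<le> E\<^sup>2 + t\<^sup>2 * n\<^sup>2" if "0 \<le> t" for t
  proof -
    \<comment> \<open>The phase of d is put into s, which turns the linear term into -2 t |d|. The
      best size is t = |d| / n^2; for n = 0 a large t contradicts d \<noteq> 0.\<close>
    let ?s = "- (complex_of_real t * sgn d)"
    have "cnj ?s * d = - complex_of_real (t * cmod d)"
      using False complex_norm_square[of d]
      by (simp add: sgn_eq field_simps power2_eq_square)
    moreover have "cmod ?s = t"
      using False that by (simp add: norm_mult norm_sgn)
    ultimately have "0 \<le> E\<^sup>2 + 2 * Re (- complex_of_real (t * cmod d)) + t\<^sup>2 * n\<^sup>2"
      using q[of ?s] by metis
    then show ?thesis
      by simp
  qed
  show ?thesis
  proof (cases "n = 0")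
    case True
    have "2 * (E\<^sup>2 + 1) \<le> E\<^sup>2"
      using q'[of "(E\<^sup>2 + 1) / cmod d"] False True by simp
    then show ?thesis
      by (smt (verit) zero_le_power2)
  next
    case n: False
    have "2 * (cmod d / n\<^sup>2) * cmod d \<le> E\<^sup>2 + (cmod d / n\<^sup>2)\<^sup>2 * n\<^sup>2"
      by (rule q') simp
    then have "(cmod d)\<^sup>2 / n\<^sup>2 \<le> E\<^sup>2"
      using n by (simp add: power2_eq_square)
    then have "(cmod d)\<^sup>2 \<le> (E * n)\<^sup>2"
      using n by (simp add: divide_le_eq power_mult_distrib)
    then show ?thesis
      by (rule power2_le_imp_le) (use assms(1,2) in simp)
  qed
qed

text \<open>Representing vectors stand in the first argument of a form, so the functionals to be
  represented, such as \<open>h u\<close> and \<open>cinner f\<close>, are conjugate-linear.\<close>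

definition antilinear_on :: "'h::complex_hilbert_space set \<Rightarrow> ('h \<Rightarrow> complex) \<Rightarrow> bool" where
  "antilinear_on V \<phi> \<longleftrightarrow>
     (\<forall>u\<in>V. \<forall>v\<in>V. \<phi> (u + v) = \<phi> u + \<phi> v) \<and> (\<forall>c. \<forall>u\<in>V. \<phi> (c *\<^sub>C u) = cnj c * \<phi> u)"

lemma antilinear_on_diff:
  "antilinear_on V \<phi> \<Longrightarrow> antilinear_on V \<psi> \<Longrightarrow> antilinear_on V (\<lambda>v. \<phi> v - \<psi> v)"
  unfolding antilinear_on_def by (auto simp: algebra_simps)

locale sesquilinear_form =
  fixes V :: "'h::complex_hilbert_space set" and h :: "'h \<Rightarrow> 'h \<Rightarrow> complex"
  assumes subspace: "complex_vector.subspace V" and sesquilinear: "sesquilinear_on V h"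
begin

lemma zero_mem [simp]: "0 \<in> V"
  and add_mem [simp]: "u \<in> V \<Longrightarrow> v \<in> V \<Longrightarrow> u + v \<in> V"
  and scale_mem [simp]: "u \<in> V \<Longrightarrow> c *\<^sub>C u \<in> V"
  and diff_mem [simp]: "u \<in> V \<Longrightarrow> v \<in> V \<Longrightarrow> u - v \<in> V"
  using subspace complex_vector.subspace_diff[OF subspace]
  by (auto simp: complex_vector.subspace_def)

lemma add_left: "u \<in> V \<Longrightarrow> v \<in> V \<Longrightarrow> w \<in> V \<Longrightarrow> h (u + v) w = h u w + h v w"
  and add_right: "u \<in> V \<Longrightarrow> v \<in> V \<Longrightarrow> w \<in> V \<Longrightarrow> h w (u + v) = h w u + h w v"
  and scale_left: "u \<in> V \<Longrightarrow> v \<in> V \<Longrightarrow> h (c *\<^sub>C u) v = c * h u v"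
  and scale_right: "u \<in> V \<Longrightarrow> v \<in> V \<Longrightarrow> h u (c *\<^sub>C v) = cnj c * h u v"
  using sesquilinear by (auto simp: sesquilinear_on_def)

lemma diff_left: "u \<in> V \<Longrightarrow> v \<in> V \<Longrightarrow> w \<in> V \<Longrightarrow> h (u - v) w = h u w - h v w"
  by (metis add_diff_cancel add_left diff_add_cancel diff_mem)

lemma diff_right: "u \<in> V \<Longrightarrow> v \<in> V \<Longrightarrow> w \<in> V \<Longrightarrow> h w (u - v) = h w u - h w v"
  by (metis add_diff_cancel add_right diff_add_cancel diff_mem)

lemmas form_simps = add_left add_right scale_left scale_right diff_left diff_right

lemma zero_left [simp]: "v \<in> V \<Longrightarrow> h 0 v = 0"
  using diff_left[of v v v] by simp

lemma antilinear_on_apply: "u \<in> V \<Longrightarrow> antilinear_on V (h u)"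
  by (simp add: antilinear_on_def add_right scale_right)

text \<open>Holds without symmetry, hence for a itself. The sector condition speaks only about a(u,
  u); this identity turns it into a bound for a(u, v).\<close>

lemma polarization:
  assumes "u \<in> V" "v \<in> V"
  shows "4 * h u v = h (u + v) (u + v) - h (u - v) (u - v)
      + \<i> * h (u + \<i> *\<^sub>C v) (u + \<i> *\<^sub>C v) - \<i> * h (u - \<i> *\<^sub>C v) (u - \<i> *\<^sub>C v)"
  using assms by (simp add: form_simps algebra_simps)

lemma parallelogram:
  assumes "u \<in> V" "v \<in> V"
  shows "h (u + v) (u + v) + h (u - v) (u - v) = 2 * h u u + 2 * h v v"
  using assms by (simp add: form_simps algebra_simps)

end

locale positive_form = sesquilinear_form +
  assumes hermitian: "u \<in> V \<Longrightarrow> v \<in> V \<Longrightarrow> h u v = cnj (h v u)"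
    and pos: "u \<in> V \<Longrightarrow> 0 \<le> Re (h u u)"
begin

definition fnorm :: "'a \<Rightarrow> real" where
  "fnorm u = sqrt (Re (h u u))"

lemma fnorm_nonneg [simp]: "u \<in> V \<Longrightarrow> 0 \<le> fnorm u"
  by (simp add: fnorm_def pos)

lemma fnorm_sq: "u \<in> V \<Longrightarrow> (fnorm u)\<^sup>2 = Re (h u u)"
  by (simp add: fnorm_def pos)

lemma fnorm_add_scale_sq:
  assumes "u \<in> V" "v \<in> V"
  shows "(fnorm (u + s *\<^sub>C v))\<^sup>2 = (fnorm u)\<^sup>2 + 2 * Re (cnj s * h u v) + (cmod s)\<^sup>2 * (fnorm v)\<^sup>2"
proof -
  have "h (u + s *\<^sub>C v) (u + s *\<^sub>C v) = h u u + cnj s * h u v + cnj (cnj s * h u v) + (s * cnj s) * h v v"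
    using assms hermitian[of v u] by (simp add: form_simps algebra_simps)
  also have "Re \<dots> = Re (h u u) + 2 * Re (cnj s * h u v) + (cmod s)\<^sup>2 * Re (h v v)"
    by (simp flip: complex_norm_square del: of_real_power)
  finally show ?thesis
    using assms by (simp add: fnorm_sq)
qed

lemma Cauchy_Schwarz:
  assumes "u \<in> V" "v \<in> V"
  shows "cmod (h u v) \<le> fnorm u * fnorm v"
proof (rule norm_le_of_quadratic_nonneg)
  fix s
  show "0 \<le> (fnorm u)\<^sup>2 + 2 * Re (cnj s * h u v) + (cmod s)\<^sup>2 * (fnorm v)\<^sup>2"
    unfolding fnorm_add_scale_sq[OF assms, symmetric] by simp
qed (use assms in auto)

lemma fnorm_scale: "u \<in> V \<Longrightarrow> fnorm (c *\<^sub>C u) = cmod c * fnorm u"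
proof -
  assume "u \<in> V"
  then have "h (c *\<^sub>C u) (c *\<^sub>C u) = complex_of_real ((cmod c)\<^sup>2) * h u u"
    unfolding complex_norm_square by (simp add: scale_left scale_right)
  then have "Re (h (c *\<^sub>C u) (c *\<^sub>C u)) = (cmod c)\<^sup>2 * Re (h u u)"
    by (simp only: times_complex.simps Re_complex_of_real Im_complex_of_real mult_zero_left diff_zero)
  then show "fnorm (c *\<^sub>C u) = cmod c * fnorm u"
    unfolding fnorm_def by (simp add: real_sqrt_mult)
qed

lemma fnorm_triangle: "u \<in> V \<Longrightarrow> v \<in> V \<Longrightarrow> fnorm (u + v) \<le> fnorm u + fnorm v"
proof -
  assume uv: "u \<in> V" "v \<in> V"
  have "(fnorm (u + v))\<^sup>2 \<le> (fnorm u + fnorm v)\<^sup>2"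
    using fnorm_add_scale_sq[OF uv, of 1] Cauchy_Schwarz[OF uv] complex_Re_le_cmod[of "h u v"]
    unfolding power2_sum by simp
  then show ?thesis
    by (rule power2_le_imp_le) (use uv in simp)
qed

text \<open>
  An almost minimiser of \<open>fnorm w ^ 2 - 2 Re (\<phi> w)\<close> almost represents \<open>\<phi>\<close>; in this way
  no completion of \<open>V\<close> is needed.
\<close>

lemma approximate_Riesz:
  assumes \<phi>: "antilinear_on V \<phi>" and bd: "\<And>v. v \<in> V \<Longrightarrow> cmod (\<phi> v) \<le> K * fnorm v"
    and "0 < \<epsilon>" and "0 \<le> K"
  obtains w where "w \<in> V" and "\<And>v. v \<in> V \<Longrightarrow> cmod (\<phi> v - h w v) \<le> \<epsilon> * fnorm v"
    and "fnorm w \<le> K + \<epsilon>"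
proof -
  define F where "F w = (fnorm w)\<^sup>2 - 2 * Re (\<phi> w)" for w
  have "- K\<^sup>2 \<le> F w" if "w \<in> V" for w
  proof -
    have "Re (\<phi> w) \<le> K * fnorm w"
      using bd[OF that] complex_Re_le_cmod[of "\<phi> w"] by linarith
    moreover have "0 \<le> (fnorm w - K)\<^sup>2"
      by simp
    ultimately show ?thesis
      unfolding F_def power2_diff by (simp add: mult.commute)
  qed
  then have bb: "bdd_below (F ` V)"
    unfolding bdd_below_def by blast
  have "\<exists>y\<in>F ` V. y < Inf (F ` V) + \<epsilon>\<^sup>2"
  proof (rule cInf_lessD)
    show "F ` V \<noteq> {}"
      using zero_mem by blast
  qed (use \<open>0 < \<epsilon>\<close> in simp)
  then obtain w where w: "w \<in> V" and "F w < Inf (F ` V) + \<epsilon>\<^sup>2"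
    by auto
  then have almost_min: "F w \<le> F v + \<epsilon>\<^sup>2" if "v \<in> V" for v
    using cInf_lower[OF _ bb, of "F v"] that by force
  have rep: "cmod (\<phi> v - h w v) \<le> \<epsilon> * fnorm v" if v: "v \<in> V" for v
  proof -
    have "cmod (h w v - \<phi> v) \<le> \<epsilon> * fnorm v"
    proof (rule norm_le_of_quadratic_nonneg)
      fix s
      \<comment> \<open>Moving w to w + s v changes \<open>F\<close> by a quadratic in s with linear
        coefficient h w v - \<phi> v. Almost minimality bounds the change below by -\<epsilon>^2, so
        \<epsilon> takes the place of E in the discriminant argument.\<close>
      have "\<phi> (w + s *\<^sub>C v) = \<phi> w + cnj s * \<phi> v"
        using \<phi> w v by (simp add: antilinear_on_def)
      then have "F (w + s *\<^sub>C v) = F w + 2 * Re (cnj s * (h w v - \<phi> v)) + (cmod s)\<^sup>2 * (fnorm v)\<^sup>2"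
        unfolding F_def fnorm_add_scale_sq[OF w v] right_diff_distrib by simp
      moreover have "F w \<le> F (w + s *\<^sub>C v) + \<epsilon>\<^sup>2"
        using w v by (intro almost_min add_mem scale_mem)
      ultimately show "0 \<le> \<epsilon>\<^sup>2 + 2 * Re (cnj s * (h w v - \<phi> v)) + (cmod s)\<^sup>2 * (fnorm v)\<^sup>2"
        by linarith
    qed (use \<open>0 < \<epsilon>\<close> v in auto)
    then show ?thesis
      by (simp add: norm_minus_commute)
  qed
  have "(fnorm w)\<^sup>2 \<le> (K + \<epsilon>) * fnorm w"
  proof -
    have "Re (h w w) \<le> cmod (\<phi> w) + cmod (\<phi> w - h w w)"
      using complex_Re_le_cmod[of "h w w"] norm_triangle_ineq4[of "\<phi> w" "\<phi> w - h w w"] by simp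
    then show ?thesis
      using bd[OF w] rep[OF w] w by (simp add: fnorm_sq algebra_simps)
  qed
  then have "fnorm w \<le> K + \<epsilon>"
    using w fnorm_nonneg[OF w] \<open>0 < \<epsilon>\<close> \<open>0 \<le> K\<close>
    by (cases "fnorm w = 0") (auto simp: power2_eq_square intro: mult_right_le_imp_le)
  with w rep show ?thesis
    using that by blast
qed

end

section \<open>Lax-Milgram in an incomplete form domain\<close>

locale coercive_form = positive_form V h + c: sesquilinear_form V c
  for V :: "'h::complex_hilbert_space set" and h c +
  fixes M \<delta> :: real
  assumes M: "\<delta> \<le> M" and \<delta>: "0 < \<delta>"
    and bound: "u \<in> V \<Longrightarrow> v \<in> V \<Longrightarrow> cmod (c u v) \<le> M * fnorm u * fnorm v"
    and coercive: "u \<in> V \<Longrightarrow> \<delta> * (fnorm u)\<^sup>2 \<le> Re (c u u)"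
begin

lemma approximation_step:
  obtains q where "0 \<le> q" "q < 1"
    "\<And>\<phi> K. antilinear_on V \<phi> \<Longrightarrow> 0 < K \<Longrightarrow> (\<And>v. v \<in> V \<Longrightarrow> cmod (\<phi> v) \<le> K * fnorm v) \<Longrightarrow>
      \<exists>u\<in>V. \<forall>v\<in>V. cmod (\<phi> v - c u v) \<le> q * K * fnorm v"
proof -
  \<comment> \<open>One step of the contraction proof of Lax-Milgram. If w and w' represented \<phi>
    and c(w, .) exactly, the residual of \<rho> w would be represented by w - \<rho> w', whose
    squared norm is at most (1 - 2 \<rho> \<delta> + \<rho>^2 M^2) times that of w. Here the error
    of w' is split off by (s + t)^2 \<le> 2 s^2 + 2 t^2, which doubles M^2; this \<rho> makes 2
    \<rho>^2 M^2 equal to \<rho> \<delta> and leaves the factor 1 - \<rho> \<delta>.\<close>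
  define \<rho> where "\<rho> = \<delta> / (2 * M\<^sup>2)"
  have \<rho>: "0 < \<rho>" "2 * \<rho> * M\<^sup>2 = \<delta>"
    using M \<delta> by (auto simp: \<rho>_def)
  \<comment> \<open>Here \<delta> \<le> M enters: it keeps \<rho> \<delta> below 1.\<close>
  have "\<delta> * \<delta> < 2 * (M * M)"
    using mult_mono[OF M M] mult_pos_pos[of M M] M \<delta> by linarith
  then have \<rho>\<delta>: "0 < \<rho> * \<delta>" "\<rho> * \<delta> < 1"
    using M \<delta> \<rho> by (auto simp: \<rho>_def power2_eq_square divide_simps)
  \<comment> \<open>Relative to K, the terms are the error of w, the error of w' times \<rho>, and
    the norm of w - \<rho> w'. At \<epsilon> = 0 this is the square root of 1 - \<rho> \<delta>, so
    continuity supplies a positive \<epsilon> with value below 1.\<close>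
  define q where
    "q \<epsilon> = \<epsilon> + \<rho> * \<epsilon> + sqrt ((1 - \<rho> * \<delta>) * (1 + \<epsilon>)\<^sup>2 + 2 * \<rho> * \<epsilon> * (1 + \<epsilon>) + 2 * \<rho>\<^sup>2 * \<epsilon>\<^sup>2)" for \<epsilon>
  have "(q \<longlongrightarrow> q 0) (at_right 0)"
    unfolding q_def by (intro tendsto_intros)
  moreover have "q 0 < 1"
    using \<rho>\<delta> by (simp add: q_def)
  ultimately have "\<forall>\<^sub>F \<epsilon> in at_right 0. q \<epsilon> < 1"
    by (rule order_tendstoD)
  then obtain \<epsilon> where \<epsilon>: "0 < \<epsilon>" "q \<epsilon> < 1"
    unfolding eventually_at_right_field using dense by blast
  have "0 \<le> q \<epsilon>"
    using \<epsilon> \<rho> \<rho>\<delta> by (simp add: q_def)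
  moreover have "\<exists>u\<in>V. \<forall>v\<in>V. cmod (\<phi> v - c u v) \<le> q \<epsilon> * K * fnorm v"
    if \<phi>: "antilinear_on V \<phi>" and K: "0 < K"
      and bd: "\<And>v. v \<in> V \<Longrightarrow> cmod (\<phi> v) \<le> K * fnorm v" for \<phi> K
  proof -
    obtain w where w: "w \<in> V" and w1: "\<And>v. v \<in> V \<Longrightarrow> cmod (\<phi> v - h w v) \<le> (\<epsilon> * K) * fnorm v"
      and w2: "fnorm w \<le> K + \<epsilon> * K"
      using approximate_Riesz[OF \<phi> bd, of "\<epsilon> * K"] \<epsilon> K by auto
    have "0 \<le> M * fnorm w"
      using M \<delta> w by auto
    then obtain w' where w': "w' \<in> V"
      and w'1: "\<And>v. v \<in> V \<Longrightarrow> cmod (c w v - h w' v) \<le> (\<epsilon> * K) * fnorm v"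
      and w'2: "fnorm w' \<le> M * fnorm w + \<epsilon> * K"
      using approximate_Riesz[OF c.antilinear_on_apply[OF w], of "M * fnorm w" "\<epsilon> * K"] \<epsilon> K bound[OF w]
      by auto
    define n where "n = fnorm w"
    have n: "0 \<le> n" "n \<le> (1 + \<epsilon>) * K"
      using w w2 by (auto simp: n_def algebra_simps)
    have "Re (c w w) - Re (h w w') \<le> \<epsilon> * K * n"
    proof -
      have "Re (h w w') = Re (h w' w)"
        using hermitian[OF w w'] by simp
      then show ?thesis
        using w'1[OF w] complex_Re_le_cmod[of "c w w - h w' w"] by (simp add: n_def)
    qed
    then have low: "\<delta> * n\<^sup>2 - \<epsilon> * K * n \<le> Re (h w w')"
      using coercive[OF w] by (simp add: n_def)
    define r where "r = fnorm (w + complex_of_real (- \<rho>) *\<^sub>C w')"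
    have r0: "0 \<le> r"
      using w w' unfolding r_def by (intro fnorm_nonneg add_mem scale_mem)
    have "r\<^sup>2 = n\<^sup>2 - 2 * \<rho> * Re (h w w') + \<rho>\<^sup>2 * (fnorm w')\<^sup>2"
      unfolding r_def fnorm_add_scale_sq[OF w w'] by (simp add: n_def)
    also have "\<dots> \<le> n\<^sup>2 - 2 * \<rho> * (\<delta> * n\<^sup>2 - \<epsilon> * K * n) + \<rho>\<^sup>2 * (2 * M\<^sup>2 * n\<^sup>2 + 2 * \<epsilon>\<^sup>2 * K\<^sup>2)"
    proof -
      have "(fnorm w')\<^sup>2 \<le> (M * n + \<epsilon> * K)\<^sup>2"
        using w'2 w' by (intro power_mono) (auto simp: n_def)
      also have "\<dots> \<le> 2 * M\<^sup>2 * n\<^sup>2 + 2 * \<epsilon>\<^sup>2 * K\<^sup>2"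
        using sum_squares_bound[of "M * n" "\<epsilon> * K"] by (simp add: power2_sum power_mult_distrib algebra_simps)
      finally have "\<rho>\<^sup>2 * (fnorm w')\<^sup>2 \<le> \<rho>\<^sup>2 * (2 * M\<^sup>2 * n\<^sup>2 + 2 * \<epsilon>\<^sup>2 * K\<^sup>2)"
        by (intro mult_left_mono) auto
      moreover have "\<rho> * (\<delta> * n\<^sup>2 - \<epsilon> * K * n) \<le> \<rho> * Re (h w w')"
        using low \<rho> by (intro mult_left_mono) auto
      ultimately show ?thesis
        by linarith
    qed
    also have "\<dots> = (1 - \<rho> * \<delta>) * n\<^sup>2 + 2 * \<rho> * \<epsilon> * K * n + 2 * \<rho>\<^sup>2 * \<epsilon>\<^sup>2 * K\<^sup>2"
      unfolding \<rho>(2)[symmetric] by (simp add: power2_eq_square algebra_simps)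
    also have "\<dots> \<le> (1 - \<rho> * \<delta>) * ((1 + \<epsilon>) * K)\<^sup>2 + 2 * \<rho> * \<epsilon> * K * ((1 + \<epsilon>) * K) + 2 * \<rho>\<^sup>2 * \<epsilon>\<^sup>2 * K\<^sup>2"
      using \<rho> \<rho>\<delta> n \<epsilon> K by (intro add_mono mult_left_mono power_mono) auto
    also have "\<dots> = ((q \<epsilon> - \<epsilon> - \<rho> * \<epsilon>) * K)\<^sup>2"
    proof -
      have "0 \<le> (1 - \<rho> * \<delta>) * (1 + \<epsilon>)\<^sup>2 + 2 * \<rho> * \<epsilon> * (1 + \<epsilon>) + 2 * \<rho>\<^sup>2 * \<epsilon>\<^sup>2"
        using \<rho> \<rho>\<delta> \<epsilon> by (intro add_nonneg_nonneg mult_nonneg_nonneg) auto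
      then show ?thesis
        by (simp add: q_def power_mult_distrib) (simp add: power2_eq_square algebra_simps)
    qed
    finally have r: "r \<le> (q \<epsilon> - \<epsilon> - \<rho> * \<epsilon>) * K"
      by (rule power2_le_imp_le) (use \<rho> \<rho>\<delta> \<epsilon> K in \<open>auto simp: q_def\<close>)
    have "cmod (\<phi> v - c (complex_of_real \<rho> *\<^sub>C w) v) \<le> q \<epsilon> * K * fnorm v" if v: "v \<in> V" for v
    proof -
      have "\<phi> v - c (complex_of_real \<rho> *\<^sub>C w) v
          = (\<phi> v - h w v) + h (w + complex_of_real (- \<rho>) *\<^sub>C w') v - \<rho> * (c w v - h w' v)"
        using w w' v by (simp only: form_simps c.form_simps scale_mem) (simp add: algebra_simps)
      also have "cmod \<dots> \<le> cmod (\<phi> v - h w v) + cmod (h (w + complex_of_real (- \<rho>) *\<^sub>C w') v)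
          + cmod (\<rho> * (c w v - h w' v))"
        by (rule order_trans[OF norm_triangle_ineq4 add_right_mono[OF norm_triangle_ineq]])
      also have "\<dots> \<le> \<epsilon> * K * fnorm v + r * fnorm v + \<rho> * (\<epsilon> * K * fnorm v)"
      proof (intro add_mono)
        show "cmod (h (w + complex_of_real (- \<rho>) *\<^sub>C w') v) \<le> r * fnorm v"
          unfolding r_def using w w' v by (intro Cauchy_Schwarz add_mem scale_mem)
        show "cmod (\<rho> * (c w v - h w' v)) \<le> \<rho> * (\<epsilon> * K * fnorm v)"
          using w'1[OF v] \<rho> by (simp add: norm_mult)
      qed (rule w1[OF v])
      also have "\<dots> = (\<epsilon> * K + r + \<rho> * (\<epsilon> * K)) * fnorm v"
        by (simp add: algebra_simps)
      also have "\<dots> \<le> (q \<epsilon> * K) * fnorm v"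
        using r v by (intro mult_right_mono) (auto simp: algebra_simps)
      finally show ?thesis .
    qed
    with w show ?thesis
      by (intro bexI[of _ "complex_of_real \<rho> *\<^sub>C w"]) auto
  qed
  ultimately show ?thesis
    using \<epsilon> that by blast
qed

text \<open>The step is iterated on the residual \<phi> - c(u, .): each correction shrinks its dual
  norm by a fixed factor. Only finitely many corrections are summed, so the result stays in
  V.\<close>

lemma approximate_Lax_Milgram:
  assumes \<phi>: "antilinear_on V \<phi>" and bd: "\<And>v. v \<in> V \<Longrightarrow> cmod (\<phi> v) \<le> K * fnorm v"
    and "0 < \<epsilon>"
  obtains u where "u \<in> V" and "\<And>v. v \<in> V \<Longrightarrow> cmod (\<phi> v - c u v) \<le> \<epsilon> * fnorm v"
proof -
  obtain q where q: "0 \<le> q" "q < 1"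
    and step: "\<And>\<phi> K. antilinear_on V \<phi> \<Longrightarrow> 0 < K \<Longrightarrow> (\<And>v. v \<in> V \<Longrightarrow> cmod (\<phi> v) \<le> K * fnorm v) \<Longrightarrow>
      \<exists>u\<in>V. \<forall>v\<in>V. cmod (\<phi> v - c u v) \<le> q * K * fnorm v"
    using approximation_step by metis
  \<comment> \<open>\<open>L\<close> and \<open>p\<close> enlarge \<open>K\<close> and
    \<open>q\<close> so that every bound p^n L is positive, as the step demands.\<close>
  define L where "L = max K 1"
  define p where "p = max q (1/2)"
  have p: "0 < p" "p < 1" "q \<le> p"
    using q by (auto simp: p_def)
  have L: "0 < L"
    by (simp add: L_def)
  have "\<exists>u\<in>V. \<forall>v\<in>V. cmod (\<phi> v - c u v) \<le> p ^ n * L * fnorm v" for n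
  proof (induction n)
    case 0
    have "cmod (\<phi> v) \<le> L * fnorm v" if "v \<in> V" for v
      using bd[OF that] mult_right_mono[of K L "fnorm v"] that by (auto simp: L_def)
    then show ?case
      by (intro bexI[of _ 0]) auto
  next
    case (Suc n)
    then obtain u where u: "u \<in> V" "\<And>v. v \<in> V \<Longrightarrow> cmod (\<phi> v - c u v) \<le> p ^ n * L * fnorm v"
      by blast
    obtain u' where u': "u' \<in> V"
      "\<And>v. v \<in> V \<Longrightarrow> cmod (\<phi> v - c u v - c u' v) \<le> q * (p ^ n * L) * fnorm v"
      using step[OF antilinear_on_diff[OF \<phi> c.antilinear_on_apply[OF u(1)]] _ u(2)] p L by auto
    have "cmod (\<phi> v - c (u + u') v) \<le> p ^ Suc n * L * fnorm v" if v: "v \<in> V" for v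
    proof -
      have "q * (p ^ n * L) * fnorm v \<le> p * (p ^ n * L) * fnorm v"
        using p L v by (intro mult_right_mono) auto
      then show ?thesis
        using u'(2)[OF v] u u'(1) v by (simp add: c.form_simps diff_diff_eq mult.assoc)
    qed
    then show ?case
      using u u' by (intro bexI[of _ "u + u'"]) auto
  qed
  moreover have "(\<lambda>n. p ^ n * L) \<longlonglongrightarrow> 0 * L"
    using p by (intro tendsto_mult LIMSEQ_realpow_zero tendsto_const) auto
  then have "\<forall>\<^sub>F n in sequentially. p ^ n * L < \<epsilon>"
    using \<open>0 < \<epsilon>\<close> by (auto dest: order_tendstoD)
  then obtain n where "p ^ n * L \<le> \<epsilon>"
    by (meson eventually_happens' less_imp_le sequentially_bot)
  ultimately obtain u where "u \<in> V" "\<And>v. v \<in> V \<Longrightarrow> cmod (\<phi> v - c u v) \<le> p ^ n * L * fnorm v"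
    by blast
  then show ?thesis
    using that \<open>p ^ n * L \<le> \<epsilon>\<close> by (meson fnorm_nonneg mult_right_mono order_trans)
qed

end

section \<open>Hilbert spaces and operators\<close>

lemma cinner_add_right: "cinner x (y + z) = cinner x y + cinner x z"
  for x :: "'h::complex_hilbert_space"
  by (metis cinner_add_left cinner_commute complex_cnj_add)

lemma cinner_scaleC_right: "cinner x (c *\<^sub>C y) = cnj c * cinner x y"
  for x :: "'h::complex_hilbert_space"
  by (metis cinner_scaleC_left cinner_commute complex_cnj_mult)

global_interpretation cinner: positive_form UNIV "cinner :: 'h::complex_hilbert_space \<Rightarrow> 'h \<Rightarrow> complex"
  by unfold_locales
    (auto simp: complex_vector.subspace_def sesquilinear_on_def cinner_add_left cinner_add_right
      cinner_scaleC_left cinner_scaleC_right cinner_self simp del: of_real_power intro: cinner_commute)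

lemma fnorm_cinner [simp]: "positive_form.fnorm cinner x = norm (x :: 'h::complex_hilbert_space)"
  by (simp add: cinner.fnorm_def cinner_self del: of_real_power)

lemma cinner_Cauchy_Schwarz: "cmod (cinner x y) \<le> norm x * norm y"
  for x :: "'h::complex_hilbert_space"
  using cinner.Cauchy_Schwarz[of x y] by simp

lemma norm_scaleC: "norm (c *\<^sub>C x) = cmod c * norm x"
  for x :: "'h::complex_hilbert_space"
  using cinner.fnorm_scale[of x c] by simp

lemma scaleC_scaleR: "c *\<^sub>C (r *\<^sub>R x) = r *\<^sub>R (c *\<^sub>C x)"
  for x :: "'h::complex_hilbert_space"
  by (simp add: scaleR_eq_scaleC scaleC_scaleC mult.commute)

lemma bounded_bilinear_scaleC:
  "bounded_bilinear ((*\<^sub>C) :: complex \<Rightarrow> 'h::complex_hilbert_space \<Rightarrow> 'h)"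
  by unfold_locales
    (auto simp: scaleC_add_left scaleC_add_right scaleC_scaleR norm_scaleC scaleC_scaleC
      scaleR_eq_scaleC scaleR_conv_of_real intro!: exI[of _ 1])

lemma bounded_bilinear_cinner:
  "bounded_bilinear (cinner :: 'h::complex_hilbert_space \<Rightarrow> 'h \<Rightarrow> complex)"
  by unfold_locales
    (auto simp: cinner_add_left cinner_add_right cinner_scaleC_left cinner_scaleC_right
      scaleR_eq_scaleC scaleR_conv_of_real intro!: exI[of _ 1] cinner_Cauchy_Schwarz)

lemmas tendsto_scaleC [tendsto_intros] = bounded_bilinear.tendsto[OF bounded_bilinear_scaleC]
lemmas tendsto_cinner [tendsto_intros] = bounded_bilinear.tendsto[OF bounded_bilinear_cinner]

lemma norm_le_if_cinner_le:
  fixes x :: "'h::complex_hilbert_space"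
  assumes "\<And>y. cmod (cinner x y) \<le> B * norm y" and "0 \<le> B"
  shows "norm x \<le> B"
proof (cases "x = 0")
  case False
  have "norm x * norm x \<le> B * norm x"
    using assms(1)[of x] by (simp add: cinner_self power2_eq_square norm_mult)
  then show ?thesis
    using False by (auto intro: mult_right_le_imp_le)
qed (use assms in simp)

lemma eq_zero_if_cinner_dense:
  fixes x :: "'h::complex_hilbert_space"
  assumes "closure V = UNIV" and "\<And>v. v \<in> V \<Longrightarrow> cinner x v = 0"
  shows "x = 0"
proof -
  obtain v where "\<And>n. v n \<in> V" "v \<longlonglongrightarrow> x"
    using assms(1) closure_sequential[of x V] by auto
  then have "(\<lambda>n. cinner x (v n)) \<longlonglongrightarrow> cinner x x"
    by (intro tendsto_intros)
  moreover have "(\<lambda>n. cinner x (v n)) = (\<lambda>n. 0)"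
    using assms(2) \<open>\<And>n. v n \<in> V\<close> by auto
  ultimately show ?thesis
    by (simp add: LIMSEQ_const_iff cinner_self)
qed

section \<open>Bounded operators and operator-valued holomorphic functions\<close>

lemma bounded_clinearI:
  fixes T :: "'h::complex_hilbert_space \<Rightarrow> 'h"
  assumes "\<And>x y. T (x + y) = T x + T y" and "\<And>c x. T (c *\<^sub>C x) = c *\<^sub>C T x"
    and "\<And>x. norm (T x) \<le> K * norm x"
  shows "bounded_clinear T"
  unfolding bounded_clinear_def
  using assms by (auto intro!: bounded_linear_intro[where K = K] simp: scaleR_eq_scaleC mult.commute)

lemma bounded_clinear_simps:
  fixes T :: "'h::complex_hilbert_space \<Rightarrow> 'h"
  assumes "bounded_clinear T"
  shows "T (x + y) = T x + T y" "T (x - y) = T x - T y" "T (c *\<^sub>C x) = c *\<^sub>C T x" "T 0 = 0"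
  using assms
  by (auto simp: bounded_clinear_def linear_simps)

text \<open>First-order Taylor remainder. The constant is the Cauchy estimate 2! B / (r/3)^2 for the
  second derivative, taken on discs of radius r/3 around points of the half disc. It depends on f
  only through B, which makes it uniform over families of functions.\<close>

lemma difference_quotient_bound:
  fixes f :: "complex \<Rightarrow> complex"
  assumes f: "f holomorphic_on ball z r" and bd: "\<And>w. w \<in> ball z r \<Longrightarrow> cmod (f w) \<le> B"
    and "w \<in> ball z (r / 2)" "w \<noteq> z"
  shows "cmod ((f w - f z) / (w - z) - deriv f z) \<le> 18 * B / r\<^sup>2 * cmod (w - z)"
proof -
  have r: "0 < r"
    using assms(3) zero_le_dist[of z w] by (simp del: zero_le_dist)
  have "cmod ((deriv ^^ Suc 1) f x) \<le> 18 * B / r\<^sup>2" if x: "x \<in> ball z (r / 2)" for x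
  proof -
    have sub: "cball x (r / 3) \<subseteq> ball z r"
    proof
      fix y assume "y \<in> cball x (r / 3)"
      then show "y \<in> ball z r"
        using x r dist_triangle[of z y x] by simp
    qed
    have "cmod ((deriv ^^ 2) f x) \<le> fact 2 * B / (r / 3) ^ 2"
    proof (rule Cauchy_inequality)
      show "f holomorphic_on ball x (r / 3)" "continuous_on (cball x (r / 3)) f"
        using f sub ball_subset_cball
        by (meson holomorphic_on_subset holomorphic_on_imp_continuous_on order_trans)+
      show "cmod (f y) \<le> B" if "cmod (x - y) = r / 3" for y
        using sub that by (intro bd) (auto simp: dist_norm)
    qed (use r in auto)
    then show ?thesis
      by (simp add: fact_2 power_divide numeral_2_eq_2)
  qed
  moreover have "((deriv ^^ i) f has_field_derivative (deriv ^^ Suc i) f x) (at x within ball z (r / 2))"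
    if "x \<in> ball z (r / 2)" for i x
    using that r unfolding funpow.simps comp_def
    by (intro holomorphic_derivI[OF holomorphic_higher_deriv[OF f]]) auto
  ultimately have "cmod ((deriv ^^ 0) f w - (\<Sum>i\<le>1. (deriv ^^ i) f z * (w - z) ^ i / fact i))
      \<le> 18 * B / r\<^sup>2 * cmod (w - z) ^ Suc 1 / fact 1"
    using assms(3) r by (intro complex_Taylor[where S = "ball z (r / 2)"]) auto
  then have "cmod (f w - f z - deriv f z * (w - z)) \<le> 18 * B / r\<^sup>2 * cmod (w - z) * cmod (w - z)"
    by (simp add: power2_eq_square algebra_simps)
  moreover have "(f w - f z) / (w - z) - deriv f z = (f w - f z - deriv f z * (w - z)) / (w - z)"
    using assms(4) by (simp add: field_simps)
  ultimately show ?thesis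
    using assms(4) by (simp add: norm_divide divide_le_eq)
qed

text \<open>
  Weak holomorphy gives differentiability in operator norm, because Cauchy's estimates for
  the functions \<open>\<lambda>z. cinner (T z x) y\<close> are uniform in unit vectors \<open>x\<close> and \<open>y\<close>.
\<close>

lemma operator_holomorphic_onI:
  fixes T :: "complex \<Rightarrow> 'h::complex_hilbert_space \<Rightarrow> 'h"
  assumes lin: "\<And>z. z \<in> \<Omega> \<Longrightarrow> bounded_clinear (T z)"
    and hol: "\<And>x y. (\<lambda>z. cinner (T z x) y) holomorphic_on \<Omega>"
    and bd: "\<And>z. z \<in> \<Omega> \<Longrightarrow> \<exists>r>0. \<exists>M\<ge>0. ball z r \<subseteq> \<Omega> \<and> (\<forall>w\<in>ball z r. \<forall>x. norm (T w x) \<le> M * norm x)"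
  shows "operator_holomorphic_on T \<Omega>"
  unfolding operator_holomorphic_on_def
proof (intro conjI ballI)
  fix z assume z: "z \<in> \<Omega>"
  obtain r M where r: "0 < r" "ball z r \<subseteq> \<Omega>" and M0: "0 \<le> M"
    and M: "\<And>w x. w \<in> ball z r \<Longrightarrow> norm (T w x) \<le> M * norm x"
    using bd[OF z] by blast
  define Q where "Q w x = (1 / (w - z)) *\<^sub>C (T w x - T z x)" for w x
  define C where "C = 18 * M / r\<^sup>2"
  \<comment> \<open>The number \<open>deriv f z\<close> cancels in the difference, so the quotients
    can be compared with each other before a derivative operator is available.\<close>
  have Q_diff: "norm (Q w x - Q w' x) \<le> C * (cmod (w - z) + cmod (w' - z)) * norm x"
    if w: "w \<in> ball z (r / 2)" "w \<noteq> z" "w' \<in> ball z (r / 2)" "w' \<noteq> z" for w w' x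
  proof (rule norm_le_if_cinner_le)
    fix y
    define f where "f w = cinner (T w x) y" for w
    have f: "f holomorphic_on ball z r"
      using holomorphic_on_subset[OF hol[of x y] r(2)] by (simp add: f_def[abs_def])
    have fb: "cmod (f w) \<le> M * norm x * norm y" if "w \<in> ball z r" for w
      using cinner_Cauchy_Schwarz[of "T w x" y] mult_right_mono[OF M[OF that], of "norm y" x]
      by (simp add: f_def)
    have "cinner (Q w x) y = (f w - f z) / (w - z)" for w
      by (simp add: Q_def f_def cinner.form_simps)
    then have "cinner (Q w x - Q w' x) y
        = ((f w - f z) / (w - z) - deriv f z) - ((f w' - f z) / (w' - z) - deriv f z)"
      by (simp add: cinner.form_simps)
    also have "cmod \<dots> \<le> 18 * (M * norm x * norm y) / r\<^sup>2 * cmod (w - z)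
        + 18 * (M * norm x * norm y) / r\<^sup>2 * cmod (w' - z)"
      by (rule order_trans[OF norm_triangle_ineq4])
        (intro add_mono difference_quotient_bound[OF f fb] w)
    also have "\<dots> = C * (cmod (w - z) + cmod (w' - z)) * norm x * norm y"
      by (simp add: C_def algebra_simps add_divide_distrib)
    finally show "cmod (cinner (Q w x - Q w' x) y) \<le> \<dots>" .
  qed (use M0 in \<open>simp add: C_def\<close>)
  \<comment> \<open>A sequence tending to z along which the derivative operator is obtained as a
    limit. \<open>Suc (Suc k)\<close> keeps even \<open>W 0\<close> strictly inside the half
    disc.\<close>
  define W where "W k = z + complex_of_real (r / 2 * inverse (real (Suc (Suc k))))" for k
  have W: "W k \<in> ball z (r / 2)" "W k \<noteq> z" for k
  proof -
    have "cmod (W k - z) = r / 2 * inverse (real (Suc (Suc k)))"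
      using r by (simp add: W_def del: of_real_mult of_nat_Suc)
    moreover have "0 < inverse (real (Suc (Suc k)))" "inverse (real (Suc (Suc k))) < 1"
      by (auto simp: inverse_less_1_iff)
    ultimately have "0 < cmod (W k - z)" "cmod (W k - z) < r / 2"
      using r by (auto simp del: of_nat_Suc)
    then show "W k \<in> ball z (r / 2)" "W k \<noteq> z"
      by (auto simp: dist_norm norm_minus_commute)
  qed
  have "(\<lambda>k. z + complex_of_real (r / 2 * inverse (real (Suc (Suc k))))) \<longlonglongrightarrow> z + complex_of_real (r / 2 * 0)"
    by (intro tendsto_intros LIMSEQ_Suc[OF LIMSEQ_inverse_real_of_nat])
  then have W_lim: "W \<longlonglongrightarrow> z"
    unfolding W_def[abs_def] by (simp only: mult_zero_right of_real_0 add_0_right)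
  have "Cauchy (\<lambda>k. Q (W k) x)" for x
  proof -
    have "(\<lambda>k. C * (cmod (W k - z) + cmod (z - z)) * norm x) \<longlonglongrightarrow> C * (cmod (z - z) + cmod (z - z)) * norm x"
      by (intro tendsto_intros W_lim)
    then have lim: "(\<lambda>k. C * cmod (W k - z) * norm x) \<longlonglongrightarrow> 0"
      by simp
    show ?thesis
    proof (rule CauchyI)
      fix e :: real assume e: "0 < e"
      then have "\<forall>\<^sub>F k in sequentially. C * cmod (W k - z) * norm x < e / 2"
        using lim by (intro order_tendstoD) auto
      then obtain n where n: "\<And>k. n \<le> k \<Longrightarrow> C * cmod (W k - z) * norm x < e / 2"
        by (auto simp: eventually_sequentially)
      have "norm (Q (W k) x - Q (W l) x) < e" if "n \<le> k" "n \<le> l" for k l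
        using Q_diff[OF W[of k] W[of l], of x] n[OF that(1)] n[OF that(2)] by (simp add: algebra_simps)
      then show "\<exists>n. \<forall>k\<ge>n. \<forall>l\<ge>n. norm (Q (W k) x - Q (W l) x) < e"
        by blast
    qed
  qed
  then obtain T' where T': "\<And>x. (\<lambda>k. Q (W k) x) \<longlonglongrightarrow> T' x"
    unfolding Cauchy_convergent_iff convergent_def by metis
  have Q_T': "norm (Q w x - T' x) \<le> C * cmod (w - z) * norm x"
    if w: "w \<in> ball z (r / 2)" "w \<noteq> z" for w x
  proof -
    have "(\<lambda>k. norm (Q w x - Q (W k) x)) \<longlonglongrightarrow> norm (Q w x - T' x)"
      by (intro tendsto_intros T')
    moreover have "(\<lambda>k. C * (cmod (w - z) + cmod (W k - z)) * norm x)
        \<longlonglongrightarrow> C * (cmod (w - z) + cmod (z - z)) * norm x"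
      by (intro tendsto_intros W_lim)
    ultimately have "norm (Q w x - T' x) \<le> C * (cmod (w - z) + cmod (z - z)) * norm x"
      using Q_diff[OF w W] by (intro LIMSEQ_le) auto
    then show ?thesis
      by simp
  qed
  have Q_lin: "Q w (x + y) = Q w x + Q w y" "Q w (c *\<^sub>C x) = c *\<^sub>C Q w x" if "w \<in> \<Omega>" for w x y c
    using lin[OF that] lin[OF z]
    by (simp_all add: Q_def bounded_clinear_simps complex_vector.scale_right_distrib
        complex_vector.scale_right_diff_distrib mult.commute)
  have W\<Omega>: "W k \<in> \<Omega>" for k
    using W(1)[of k] r by (intro subsetD[OF r(2)]) (auto simp: field_simps)
  have T'_lin: "T' (x + y) = T' x + T' y" "T' (c *\<^sub>C x) = c *\<^sub>C T' x" for x y c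
  proof -
    show "T' (x + y) = T' x + T' y"
      by (rule LIMSEQ_unique[OF T']) (simp add: Q_lin(1) W\<Omega> tendsto_add T')
    show "T' (c *\<^sub>C x) = c *\<^sub>C T' x"
      by (rule LIMSEQ_unique[OF T']) (simp add: Q_lin(2) W\<Omega> tendsto_scaleC T')
  qed
  have "norm (T' x) \<le> (C * cmod (W 0 - z) + cmod (1 / (W 0 - z)) * (M + M)) * norm x" for x
  proof -
    have "W 0 \<in> ball z r" "z \<in> ball z r"
      using W(1)[of 0] r by (auto simp: field_simps)
    then have "norm (T (W 0) x - T z x) \<le> (M + M) * norm x"
      using M[of "W 0" x] M[of z x] norm_triangle_ineq4[of "T (W 0) x" "T z x"]
      by (simp add: distrib_right)
    then have "norm (Q (W 0) x) \<le> cmod (1 / (W 0 - z)) * ((M + M) * norm x)"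
      unfolding Q_def norm_scaleC by (intro mult_left_mono) auto
    moreover have "norm (T' x) \<le> norm (Q (W 0) x - T' x) + norm (Q (W 0) x)"
      by (metis norm_minus_commute norm_triangle_sub add.commute)
    ultimately show ?thesis
      using Q_T'[OF W, of 0 x] by (simp add: algebra_simps)
  qed
  then have bT': "bounded_clinear T'"
    by (intro bounded_clinearI T'_lin)
  have "((\<lambda>w. onorm (\<lambda>x. Q w x - T' x)) \<longlongrightarrow> 0) (at z within \<Omega>)"
  proof (rule tendsto_sandwich[of "\<lambda>_. 0"])
    have ev: "\<forall>\<^sub>F w in at z within \<Omega>. w \<in> ball z (r / 2) \<and> w \<noteq> z \<and> w \<in> \<Omega>"
      using r unfolding eventually_at by (intro exI[of _ "r / 2"]) (auto simp: dist_commute)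
    show "\<forall>\<^sub>F w in at z within \<Omega>. 0 \<le> onorm (\<lambda>x. Q w x - T' x)"
      using ev
    proof eventually_elim
      case (elim w)
      have "bounded_linear (\<lambda>x. (1 / (w - z)) *\<^sub>C (T w x - T z x) - T' x)"
        using lin[of w] elim lin[OF z] bT' unfolding bounded_clinear_def
        by (intro bounded_linear_sub bounded_linear_compose[OF
              bounded_bilinear.bounded_linear_right[OF bounded_bilinear_scaleC]]) auto
      then show ?case
        unfolding Q_def by (rule onorm_pos_le)
    qed
    show "\<forall>\<^sub>F w in at z within \<Omega>. onorm (\<lambda>x. Q w x - T' x) \<le> \<bar>C\<bar> * cmod (w - z)"
      using ev
    proof eventually_elim
      case (elim w)
      have "norm (Q w x - T' x) \<le> \<bar>C\<bar> * cmod (w - z) * norm x" for x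
        by (rule order_trans[OF Q_T']) (use elim in \<open>auto intro!: mult_right_mono\<close>)
      then show ?case
        by (intro onorm_bound) auto
    qed
    have "((\<lambda>w. \<bar>C\<bar> * cmod (w - z)) \<longlongrightarrow> \<bar>C\<bar> * cmod (z - z)) (at z within \<Omega>)"
      by (intro tendsto_intros)
    then show "((\<lambda>w. \<bar>C\<bar> * cmod (w - z)) \<longlongrightarrow> 0) (at z within \<Omega>)"
      by simp
  qed auto
  with bT' show "\<exists>T'. bounded_clinear T' \<and>
        ((\<lambda>w. onorm (\<lambda>x. (1 / (w - z)) *\<^sub>C (T w x - T z x) - T' x)) \<longlongrightarrow> 0) (at z within \<Omega>)"
    unfolding Q_def by blast
qed (rule lin)

section \<open>Semigroups by Euler's formula\<close>

lemma funpow_commute: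
  assumes "\<And>x. f (g x) = g (f x)"
  shows "(f ^^ n) (g x) = g ((f ^^ n) x)"
  using assms by (induction n) auto

lemma funpow_comp_commute:
  assumes "\<And>x. f (g x) = g (f x)"
  shows "((\<lambda>x. f (g x)) ^^ n) x = (f ^^ n) ((g ^^ n) x)"
proof (induction n)
  case (Suc n)
  have "(f ^^ n) (g y) = g ((f ^^ n) y)" for y
    using assms by (rule funpow_commute)
  with Suc show ?case by simp
qed simp

lemma nonexpansive_funpow:
  fixes f :: "'a::real_normed_vector \<Rightarrow> 'a"
  assumes "\<And>x y. norm (f x - f y) \<le> norm (x - y)"
  shows "norm ((f ^^ n) x - (f ^^ n) y) \<le> norm (x - y)"
  using assms by (induction n) (auto intro: order_trans)

text \<open>Telescoping, with commutation used to write f (g x) - g (g x) as g (f x) - g (g x). Thus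
  the one-step defect is measured at x alone, where the expansion of the resolvent is available, and
  not along the orbit.\<close>

lemma norm_funpow_diff_le:
  fixes f g :: "'a::real_normed_vector \<Rightarrow> 'a"
  assumes f: "\<And>x y. norm (f x - f y) \<le> norm (x - y)" and g: "\<And>x y. norm (g x - g y) \<le> norm (x - y)"
    and comm: "\<And>x. f (g x) = g (f x)"
  shows "norm ((f ^^ n) x - (g ^^ n) x) \<le> real n * norm (f x - g x)"
proof (induction n arbitrary: x)
  case (Suc n)
  have "norm ((f ^^ n) (g x) - (g ^^ n) (g x)) \<le> real n * norm (f x - g x)"
    using Suc[of "g x"] mult_left_mono[OF g[of "f x" "g x"], of "real n"] by (simp add: comm)
  moreover have "norm ((f ^^ n) (f x) - (f ^^ n) (g x)) \<le> norm (f x - g x)"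
    using f by (rule nonexpansive_funpow)
  ultimately show ?case
    using norm_triangle_ineq[of "(f ^^ n) (f x) - (f ^^ n) (g x)" "(f ^^ n) (g x) - (g ^^ n) (g x)"]
    by (simp add: funpow_swap1 algebra_simps)
qed simp

lemma bounded_clinear_funpow:
  assumes "bounded_clinear T"
  shows "bounded_clinear (T ^^ n)"
proof (induction n)
  case 0
  then show ?case by (auto simp: bounded_clinear_def id_def)
next
  case (Suc n)
  then show ?case
    using assms by (auto simp: bounded_clinear_def comp_def intro: bounded_linear_compose)
qed

lemma LIMSEQ_zero_norm_le:
  fixes f :: "nat \<Rightarrow> 'a::real_normed_vector"
  assumes "g \<longlonglongrightarrow> 0" and "\<And>n. norm (f n) \<le> g n"
  shows "f \<longlonglongrightarrow> 0"
  using assms by (intro Lim_null_comparison[of f g]) auto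

section \<open>Resolvents of an operator that is m-accretive along an open cone\<close>

locale accretive_operator =
  fixes D :: "'h::complex_hilbert_space set" and A :: "'h \<Rightarrow> 'h" and S :: "complex set"
  assumes operator_in: "operator_in D A"
    and dense: "closure D = UNIV"
    and open_S: "open S" and zero_notin: "0 \<notin> S" and one_in: "1 \<in> S"
    and S_add: "z \<in> S \<Longrightarrow> w \<in> S \<Longrightarrow> z + w \<in> S"
    and S_scale: "z \<in> S \<Longrightarrow> 0 < t \<Longrightarrow> complex_of_real t * z \<in> S"
    and surjective: "z \<in> S \<Longrightarrow> \<exists>x\<in>D. x + z *\<^sub>C A x = f"
    and accretive: "z \<in> S \<Longrightarrow> x \<in> D \<Longrightarrow> norm x \<le> norm (x + z *\<^sub>C A x)"
begin

lemma D_simps [simp]: "0 \<in> D" "x \<in> D \<Longrightarrow> y \<in> D \<Longrightarrow> x + y \<in> D" "x \<in> D \<Longrightarrow> c *\<^sub>C x \<in> D"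
    "x \<in> D \<Longrightarrow> y \<in> D \<Longrightarrow> x - y \<in> D"
  using operator_in complex_vector.subspace_diff[of D x y]
  by (auto simp: operator_in_def complex_vector.subspace_def)

lemma A_add: "x \<in> D \<Longrightarrow> y \<in> D \<Longrightarrow> A (x + y) = A x + A y"
  and A_scale: "x \<in> D \<Longrightarrow> A (c *\<^sub>C x) = c *\<^sub>C A x"
  using operator_in by (auto simp: operator_in_def)

lemma A_diff: "x \<in> D \<Longrightarrow> y \<in> D \<Longrightarrow> A (x - y) = A x - A y"
  by (metis A_add D_simps(4) add_diff_cancel diff_add_cancel)

lemma S_divide: "z \<in> S \<Longrightarrow> 0 < n \<Longrightarrow> z / of_nat n \<in> S"
  using S_scale[of z "1 / real n"] by simp

lemma S_of_real: "0 < t \<Longrightarrow> complex_of_real t \<in> S"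
  using S_scale[OF one_in] by simp

text \<open>This is (1 + zA)^{-1}, that is 1/z times the resolvent of -A at 1/z. The locale
  assumptions make zA m-accretive for every z in S, so that \<open>J z\<close> is a contraction
  defined on all of H.\<close>

definition J :: "complex \<Rightarrow> 'h \<Rightarrow> 'h" where
  "J z f = (THE x. x \<in> D \<and> x + z *\<^sub>C A x = f)"

context
  fixes z assumes z: "z \<in> S"
begin

lemma J_ex1: "\<exists>!x. x \<in> D \<and> x + z *\<^sub>C A x = f"
proof (rule ex_ex1I)
  show "\<exists>x. x \<in> D \<and> x + z *\<^sub>C A x = f"
    using surjective[OF z] by blast
  fix x y assume xy: "x \<in> D \<and> x + z *\<^sub>C A x = f" "y \<in> D \<and> y + z *\<^sub>C A y = f"
  then have "(x - y) + z *\<^sub>C A (x - y) = 0"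
    by (simp add: A_diff complex_vector.scale_right_diff_distrib algebra_simps)
  then show "x = y"
    using accretive[OF z, of "x - y"] xy by simp
qed

lemma J_mem [simp]: "J z f \<in> D" and J_eq: "J z f + z *\<^sub>C A (J z f) = f"
  using theI'[OF J_ex1[of f]] by (auto simp: J_def)

lemma J_unique: "x \<in> D \<Longrightarrow> x + z *\<^sub>C A x = f \<Longrightarrow> J z f = x"
  using J_ex1[of f] J_mem[of f] J_eq[of f] by blast

lemma norm_J_le: "norm (J z f) \<le> norm f"
  using accretive[OF z J_mem[of f]] by (simp add: J_eq)

lemma bounded_clinear_J: "bounded_clinear (J z)"
proof (rule bounded_clinearI[where K = 1])
  fix f g c
  show "J z (f + g) = J z f + J z g"
    using J_eq[of f] J_eq[of g]
    by (intro J_unique) (auto simp: A_add complex_vector.scale_right_distrib algebra_simps)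
  have "c *\<^sub>C (J z f + z *\<^sub>C A (J z f)) = c *\<^sub>C J z f + z *\<^sub>C A (c *\<^sub>C J z f)"
    by (simp add: A_scale complex_vector.scale_right_distrib mult.commute)
  then show "J z (c *\<^sub>C f) = c *\<^sub>C J z f"
    by (intro J_unique) (auto simp: J_eq)
qed (simp add: norm_J_le)

lemmas J_linear = bounded_clinear_simps[OF bounded_clinear_J]

lemma J_nonexpansive: "norm (J z x - J z y) \<le> norm (x - y)"
  using norm_J_le[of "x - y"] by (simp add: J_linear)

text \<open>The equation for y = J z x reads A y = (x - y) / z. For x in D the right-hand side is
  again in D, so A may be applied to the equation.\<close>

lemma A_J: "x \<in> D \<Longrightarrow> A (J z x) \<in> D \<and> A (J z x) = J z (A x)"
proof -
  assume x: "x \<in> D"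
  define y where "y = J z x"
  have y: "y \<in> D" "y + z *\<^sub>C A y = x"
    by (auto simp: y_def J_eq)
  have "z \<noteq> 0"
    using z zero_notin by auto
  moreover have zA: "z *\<^sub>C A y = x - y"
    using y by (simp add: algebra_simps)
  ultimately have "A y = (1 / z) *\<^sub>C (x - y)"
    by (simp flip: zA)
  then have Ay: "A y \<in> D"
    using x y by simp
  then have "A y + z *\<^sub>C A (A y) = A (y + z *\<^sub>C A y)"
    using y(1) Ay by (simp add: A_add A_scale)
  then have "J z (A x) = A y"
    using Ay y by (intro J_unique) auto
  with Ay show ?thesis
    by (simp add: y_def)
qed

lemma J_diff: "x \<in> D \<Longrightarrow> J z x - x = - (z *\<^sub>C J z (A x))"
  using J_eq[of x] A_J[of x] by (simp add: algebra_simps eq_neg_iff_add_eq_0)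

lemma norm_Jpow_le: "norm ((J z ^^ k) x) \<le> norm x"
  by (induction k) (auto intro: order_trans[OF norm_J_le])

lemma norm_Jpow_diff_le: "x \<in> D \<Longrightarrow> norm ((J z ^^ k) x - x) \<le> real k * (cmod z * norm (A x))"
proof (induction k)
  case (Suc k)
  have "(J z ^^ Suc k) x - x = J z ((J z ^^ k) x - x) - z *\<^sub>C J z (A x)"
    using Suc(2) J_diff[of x] by (simp add: J_linear algebra_simps)
  then have "norm ((J z ^^ Suc k) x - x) \<le> norm ((J z ^^ k) x - x) + cmod z * norm (A x)"
    using norm_triangle_ineq4[of "J z ((J z ^^ k) x - x)" "z *\<^sub>C J z (A x)"]
      norm_J_le[of "(J z ^^ k) x - x"] mult_left_mono[OF norm_J_le[of "A x"], of "cmod z"]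
    by (simp add: norm_scaleC)
  then show ?case
    using Suc by (simp add: algebra_simps)
qed simp

text \<open>The vector y stands in for A x, which need not lie in D. With y = A x this is a
  second-order estimate on the domain of the square of A; with y merely close to A x it still yields
  the derivative at 0 for every x in D. The bound depends only on k |z|, so it survives the limit in
  Euler's formula.\<close>

lemma norm_Jpow_diff_le2:
  assumes x: "x \<in> D" and y: "y \<in> D"
  shows "norm ((J z ^^ k) x - x + (of_nat k * z) *\<^sub>C A x)
    \<le> 2 * (real k * cmod z) * norm (A x - y) + (real k * cmod z)\<^sup>2 * norm (A y)"
proof (induction k)
  case (Suc k)
  let ?R = "\<lambda>k. (J z ^^ k) x - x + (of_nat k * z) *\<^sub>C A x"
  have step: "(J z ^^ Suc k) x - (J z ^^ k) x = - (z *\<^sub>C (J z ^^ Suc k) (A x))"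
  proof -
    have "(J z ^^ Suc k) x - (J z ^^ k) x = (J z ^^ k) (J z x - x)"
      by (simp add: bounded_clinear_simps[OF bounded_clinear_funpow[OF bounded_clinear_J]] funpow_swap1)
    also have "J z x - x = (- z) *\<^sub>C J z (A x)"
      using J_diff[OF x] by simp
    finally show ?thesis
      by (simp only: bounded_clinear_simps[OF bounded_clinear_funpow[OF bounded_clinear_J]])
        (simp add: funpow_swap1)
  qed
  have "?R (Suc k) = ?R k + ((J z ^^ Suc k) x - (J z ^^ k) x) + z *\<^sub>C A x"
    by (simp add: scaleC_add_left algebra_simps)
  also have "\<dots> = ?R k + z *\<^sub>C (A x - (J z ^^ Suc k) (A x))"
    unfolding step by (simp add: complex_vector.scale_right_diff_distrib)
  finally have "norm (?R (Suc k)) \<le> norm (?R k) + cmod z * norm (A x - (J z ^^ Suc k) (A x))"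
    using norm_triangle_ineq[of "?R k" "z *\<^sub>C (A x - (J z ^^ Suc k) (A x))"]
    by (simp only: norm_scaleC)
  also have "cmod z * norm (A x - (J z ^^ Suc k) (A x))
      \<le> cmod z * (2 * norm (A x - y) + real (Suc k) * (cmod z * norm (A y)))"
  proof (rule mult_left_mono)
    show "norm (A x - (J z ^^ Suc k) (A x)) \<le> 2 * norm (A x - y) + real (Suc k) * (cmod z * norm (A y))"
    proof -
      \<comment> \<open>Only y is known to be in D and gets the first-order bound; A x - y gets
        contractivity.\<close>
      have "A x - (J z ^^ Suc k) (A x) = (A x - y) - (J z ^^ Suc k) (A x - y) - ((J z ^^ Suc k) y - y)"
        unfolding bounded_clinear_simps[OF bounded_clinear_funpow[OF bounded_clinear_J]] by simp
      also have "norm \<dots> \<le> norm (A x - y) + norm ((J z ^^ Suc k) (A x - y)) + norm ((J z ^^ Suc k) y - y)"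
        by (rule order_trans[OF norm_triangle_ineq4 add_right_mono[OF norm_triangle_ineq4]])
      also have "\<dots> \<le> norm (A x - y) + norm (A x - y) + real (Suc k) * (cmod z * norm (A y))"
        by (intro add_mono order_refl norm_Jpow_le norm_Jpow_diff_le y)
      finally show ?thesis
        by simp
    qed
  qed simp
  also have "norm (?R k) + cmod z * (2 * norm (A x - y) + real (Suc k) * (cmod z * norm (A y)))
      \<le> 2 * (real k * cmod z) * norm (A x - y) + (real k * cmod z)\<^sup>2 * norm (A y)
      + cmod z * (2 * norm (A x - y) + real (Suc k) * (cmod z * norm (A y)))"
    by (intro add_right_mono Suc)
  also have "\<dots> = 2 * (real (Suc k) * cmod z) * norm (A x - y)
      + ((real k)\<^sup>2 + real (Suc k)) * ((cmod z)\<^sup>2 * norm (A y))"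
    by (simp add: algebra_simps power2_eq_square)
  also have "\<dots> \<le> 2 * (real (Suc k) * cmod z) * norm (A x - y)
      + (real (Suc k))\<^sup>2 * ((cmod z)\<^sup>2 * norm (A y))"
  proof -
    have "(real k)\<^sup>2 + real (Suc k) \<le> (real (Suc k))\<^sup>2"
      by (simp add: power2_eq_square algebra_simps)
    then show ?thesis
      by (intro add_left_mono mult_right_mono) simp_all
  qed
  finally show ?case
    by (simp only: power_mult_distrib mult.assoc)
qed simp

end

text \<open>Resolvent identity, from applying \<open>J w\<close> to g = p + z A p. The unbounded
  factor sits at z: \<open>A (J z g)\<close> does not depend on w, so the right-hand side is small
  as w tends to z.\<close>

lemma J_resolvent:
  assumes z: "z \<in> S" and w: "w \<in> S"
  shows "J w g - J z g = (z - w) *\<^sub>C J w (A (J z g))"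
proof -
  define p where "p = J z g"
  have "J w g = J w p + z *\<^sub>C J w (A p)"
    using J_eq[OF z, of g] J_linear[OF w] by (metis p_def)
  moreover have "J w p = p - w *\<^sub>C J w (A p)"
    using J_diff[OF w, of p] z by (simp add: p_def algebra_simps)
  ultimately show ?thesis
    by (simp add: p_def[symmetric] complex_vector.scale_left_diff_distrib)
qed

lemma J_commute: "z \<in> S \<Longrightarrow> w \<in> S \<Longrightarrow> J z (J w f) = J w (J z f)"
proof (rule J_unique)
  assume z: "z \<in> S" and w: "w \<in> S"
  have "J w f = J w (J z f) + z *\<^sub>C J w (A (J z f))"
    using J_eq[OF z, of f] J_linear[OF w] by metis
  then show "J w (J z f) + z *\<^sub>C A (J w (J z f)) = J w f"
    using A_J[OF w, of "J z f"] z by simp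
qed auto

section \<open>Euler approximants and their limit\<close>

definition E :: "nat \<Rightarrow> complex \<Rightarrow> 'h \<Rightarrow> 'h" where
  "E n z = (J (z / of_nat n) ^^ n)"

lemma norm_E_diff_le:
  assumes z: "z \<in> S" and n: "0 < n" and x: "x \<in> D"
  shows "norm (E n z x - x) \<le> cmod z * norm (A x)"
  using norm_Jpow_diff_le[OF S_divide[OF z n] x, of n] n by (simp add: E_def norm_divide)

lemma norm_E_diff_le2:
  assumes z: "z \<in> S" and n: "0 < n" and x: "x \<in> D" and y: "y \<in> D"
  shows "norm (E n z x - x + z *\<^sub>C A x) \<le> 2 * cmod z * norm (A x - y) + (cmod z)\<^sup>2 * norm (A y)"
  using norm_Jpow_diff_le2[OF S_divide[OF z n] x y, of n] n by (simp add: E_def norm_divide)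

lemma bounded_clinear_E: "z \<in> S \<Longrightarrow> 0 < n \<Longrightarrow> bounded_clinear (E n z)"
  unfolding E_def by (intro bounded_clinear_funpow bounded_clinear_J S_divide)

lemma norm_E_le: "z \<in> S \<Longrightarrow> 0 < n \<Longrightarrow> norm (E n z x) \<le> norm x"
  unfolding E_def by (intro norm_Jpow_le S_divide)

text \<open>One step of size v = z/m is compared with n steps of size v/n; both agree with x - v A x
  up to |v|^2 times the norm of A (A x). Over m steps the defect is multiplied by m, and m |v|^2 =
  |z|^2 / m. Arbitrary indices m and n are then compared through their common refinement m
  n.\<close>

lemma norm_E_diff_mult_le:
  assumes z: "z \<in> S" and m: "0 < m" and n: "0 < n" and x: "x \<in> D" "A x \<in> D"
  shows "norm (E m z x - E (m * n) z x) \<le> 2 * (cmod z)\<^sup>2 * norm (A (A x)) / real m"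
proof -
  define v where "v = z / of_nat m"
  have v: "v \<in> S"
    using z m by (simp add: v_def S_divide)
  define w where "w = v / of_nat n"
  have w: "w \<in> S"
    using v n by (simp add: w_def S_divide)
  have local: "norm (J v x - (J w ^^ n) x) \<le> 2 * (cmod v)\<^sup>2 * norm (A (A x))"
  proof -
    have "norm (J v x - x + v *\<^sub>C A x) \<le> (cmod v)\<^sup>2 * norm (A (A x))"
      using norm_Jpow_diff_le2[OF v x, of 1] by simp
    moreover have "norm ((J w ^^ n) x - x + v *\<^sub>C A x) \<le> (cmod v)\<^sup>2 * norm (A (A x))"
      using norm_E_diff_le2[OF v n x] by (simp add: E_def w_def)
    moreover have "J v x - (J w ^^ n) x = (J v x - x + v *\<^sub>C A x) - ((J w ^^ n) x - x + v *\<^sub>C A x)"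
      by simp
    ultimately show ?thesis
      using norm_triangle_ineq4[of "J v x - x + v *\<^sub>C A x" "(J w ^^ n) x - x + v *\<^sub>C A x"] by simp
  qed
  have ne: "norm ((J w ^^ n) x - (J w ^^ n) y) \<le> norm (x - y)" for x y
    by (rule nonexpansive_funpow[of "J w", OF J_nonexpansive[OF w]])
  have comm: "J v ((J w ^^ n) x) = (J w ^^ n) (J v x)" for x
    by (rule sym, rule funpow_commute[of "J w" "J v"], rule J_commute[OF w v])
  have "norm ((J v ^^ m) x - ((J w ^^ n) ^^ m) x) \<le> real m * norm (J v x - (J w ^^ n) x)"
    by (rule norm_funpow_diff_le[of "J v" "J w ^^ n", OF J_nonexpansive[OF v] ne comm])
  also have "\<dots> \<le> real m * (2 * (cmod v)\<^sup>2 * norm (A (A x)))"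
    using local by (rule mult_left_mono) simp
  also have "\<dots> = 2 * (cmod z)\<^sup>2 * norm (A (A x)) / real m"
    using m by (simp add: v_def norm_divide power2_eq_square)
  finally show ?thesis
    by (simp add: E_def v_def w_def funpow_mult mult.commute)
qed

lemma norm_E_diff_E_le:
  assumes z: "z \<in> S" and m: "0 < m" and n: "0 < n" and x: "x \<in> D" "A x \<in> D"
  shows "norm (E m z x - E n z x) \<le> 2 * (cmod z)\<^sup>2 * norm (A (A x)) * (1 / real m + 1 / real n)"
proof -
  have "norm (E n z x - E (m * n) z x) \<le> 2 * (cmod z)\<^sup>2 * norm (A (A x)) / real n"
    using norm_E_diff_mult_le[OF z n m x] by (simp only: mult.commute[of m n])
  then show ?thesis
    using norm_E_diff_mult_le[OF z m n x]
      norm_triangle_ineq4[of "E m z x - E (m * n) z x" "E n z x - E (m * n) z x"]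
    by (simp add: distrib_left)
qed

text \<open>\<open>J 1\<close> maps D into the domain of the square of A. Being a contraction with
  range D, it maps the dense set D onto a set whose closure contains D.\<close>

lemma dense_domain_square: "closure {x \<in> D. A x \<in> D} = UNIV"
proof -
  have "\<exists>y\<in>{x \<in> D. A x \<in> D}. dist y x < e" if e: "0 < e" for x :: 'h and e
  proof -
    have approx: "\<exists>y\<in>D. dist y x < e / 2" for x
    proof -
      have "\<forall>e>0. \<exists>y\<in>D. dist y x < e"
        using dense by (simp flip: closure_approachable)
      then show ?thesis
        using half_gt_zero[OF e] by blast
    qed
    obtain y where y: "y \<in> D" "dist y x < e / 2"
      using approx by blast
    obtain g where g: "g \<in> D" "dist g (y + 1 *\<^sub>C A y) < e / 2"
      using approx by blast
    have "J 1 (y + 1 *\<^sub>C A y) = y"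
      using y by (intro J_unique one_in) auto
    then have "dist (J 1 g) y < e / 2"
      using J_nonexpansive[OF one_in, of g "y + 1 *\<^sub>C A y"] g(2) by (simp add: dist_norm)
    then have "dist (J 1 g) x < e"
      using y(2) dist_triangle[of "J 1 g" x y] by simp
    moreover have "J 1 g \<in> {x \<in> D. A x \<in> D}"
      using A_J[OF one_in g(1)] one_in by simp
    ultimately show ?thesis
      by blast
  qed
  then show ?thesis
    using closure_approachable by blast
qed

text \<open>Passing from x to a nearby y in the domain of the square of A costs at most the
  distance, for every z in S and every index, because the approximants are contractions. Hence the
  same N serves all z with |z| \<le> R, as holomorphy of the limit demands.\<close>

lemma uniformly_Cauchy_E:
  assumes "0 < e"
  obtains N where "0 < N"
    "\<And>m n z. N \<le> m \<Longrightarrow> N \<le> n \<Longrightarrow> z \<in> S \<Longrightarrow> cmod z \<le> R \<Longrightarrow> norm (E m z x - E n z x) < e"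
proof -
  have "x \<in> closure {x \<in> D. A x \<in> D}"
    using dense_domain_square by simp
  then have "\<forall>e>0. \<exists>y\<in>{x \<in> D. A x \<in> D}. dist y x < e"
    by (simp only: closure_approachable)
  moreover have "0 < e / 4"
    using assms by simp
  ultimately obtain y where y: "y \<in> D" "A y \<in> D" "norm (y - x) < e / 4"
    unfolding dist_norm by blast
  define B where "B = 2 * R\<^sup>2 * norm (A (A y))"
  have "(\<lambda>n. B * (inverse (real (Suc n)) + inverse (real (Suc n)))) \<longlonglongrightarrow> B * (0 + 0)"
    by (intro tendsto_intros LIMSEQ_inverse_real_of_nat)
  then have "\<forall>\<^sub>F n in sequentially. B * (inverse (real (Suc n)) + inverse (real (Suc n))) < e / 2"
    using assms by (intro order_tendstoD) auto
  then obtain k where k: "B * (inverse (real (Suc k)) + inverse (real (Suc k))) < e / 2"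
    by (meson eventually_happens' sequentially_bot)
  have "norm (E m z x - E n z x) < e"
    if mn: "Suc k \<le> m" "Suc k \<le> n" and z: "z \<in> S" "cmod z \<le> R" for m n z
  proof -
    have mn0: "0 < m" "0 < n"
      using mn by auto
    have E: "norm (E m z x - E m z y) < e / 4" if "0 < m" for m
      using norm_E_le[OF z(1) that, of "x - y"] y(3)
      by (simp add: bounded_clinear_simps[OF bounded_clinear_E[OF z(1) that]] norm_minus_commute)
    have "norm (E m z y - E n z y) \<le> 2 * (cmod z)\<^sup>2 * norm (A (A y)) * (1 / real m + 1 / real n)"
      by (intro norm_E_diff_E_le z y mn0)
    also have "\<dots> \<le> B * (inverse (real (Suc k)) + inverse (real (Suc k)))"
      unfolding B_def using z mn mn0
      by (intro mult_mono add_mono power_mono) (auto simp: field_simps)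
    finally have "norm (E m z y - E n z y) < e / 2"
      using k by linarith
    have eq: "E m z x - E n z x = (E m z x - E m z y) + (E m z y - E n z y) - (E n z x - E n z y)"
      by simp
    show ?thesis
      unfolding eq using \<open>norm (E m z y - E n z y) < e / 2\<close> E[OF mn0(1)] E[OF mn0(2)]
        norm_triangle_ineq4[of "(E m z x - E m z y) + (E m z y - E n z y)" "E n z x - E n z y"]
        norm_triangle_ineq[of "E m z x - E m z y" "E m z y - E n z y"]
      by linarith
  qed
  then show ?thesis
    using that[of "Suc k"] by blast
qed

text \<open>Plays the role of exp(-zA), for z in S. The index starts at 1 because \<open>E 0\<close>
  is the identity and is not covered by the estimates.\<close>

definition T :: "complex \<Rightarrow> 'h \<Rightarrow> 'h" where
  "T z x = lim (\<lambda>n. E (Suc n) z x)"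

lemma E_tendsto: 
  assumes z: "z \<in> S"
  shows "(\<lambda>n. E (Suc n) z x) \<longlonglongrightarrow> T z x"
proof -
  have "Cauchy (\<lambda>n. E (Suc n) z x)"
  proof (rule CauchyI)
    fix e :: real assume "0 < e"
    then obtain N where "\<And>m n. N \<le> m \<Longrightarrow> N \<le> n \<Longrightarrow> norm (E m z x - E n z x) < e"
      using uniformly_Cauchy_E[of e "cmod z" x] z by (metis order_refl)
    then show "\<exists>M. \<forall>m\<ge>M. \<forall>n\<ge>M. norm (E (Suc m) z x - E (Suc n) z x) < e"
      by (intro exI[of _ N]) auto
  qed
  then show ?thesis
    unfolding T_def by (simp add: Cauchy_convergent_iff convergent_LIMSEQ_iff)
qed

lemma uniform_limit_E: "uniform_limit (S \<inter> cball 0 R) (\<lambda>n z. E (Suc n) z x) (\<lambda>z. T z x) sequentially"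
proof (rule uniform_limitI)
  fix e :: real assume e: "0 < e"
  then obtain N where N: "\<And>m n z. N \<le> m \<Longrightarrow> N \<le> n \<Longrightarrow> z \<in> S \<Longrightarrow> cmod z \<le> R \<Longrightarrow> norm (E m z x - E n z x) < e / 2"
    using uniformly_Cauchy_E[of "e / 2" R x] by (metis half_gt_zero)
  have "dist (E (Suc n) z x) (T z x) < e" if n: "N \<le> n" and z: "z \<in> S \<inter> cball 0 R" for n z
  proof -
    have "(\<lambda>m. norm (E (Suc n) z x - E (Suc m) z x)) \<longlonglongrightarrow> norm (E (Suc n) z x - T z x)"
      using z by (intro tendsto_intros E_tendsto) auto
    then have "norm (E (Suc n) z x - T z x) \<le> e / 2"
      by (rule LIMSEQ_le_const2) (use N[of "Suc n" "Suc _" z] n z in \<open>auto intro!: exI[of _ N] less_imp_le\<close>)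
    then show ?thesis
      using e by (simp add: dist_norm)
  qed
  then show "\<forall>\<^sub>F n in sequentially. \<forall>z\<in>S \<inter> cball 0 R. dist (E (Suc n) z x) (T z x) < e"
    by (auto simp: eventually_sequentially intro!: exI[of _ N])
qed

lemma norm_T_le:
  assumes z: "z \<in> S"
  shows "norm (T z x) \<le> norm x"
  by (rule LIMSEQ_le_const2[OF tendsto_norm[OF E_tendsto[OF z]]]) (simp add: norm_E_le z)

lemma bounded_clinear_T:
  assumes z: "z \<in> S"
  shows "bounded_clinear (T z)"
proof (rule bounded_clinearI[where K = 1])
  fix x y c
  note E_simps = bounded_clinear_simps[OF bounded_clinear_E[OF z zero_less_Suc]]
  show "T z (x + y) = T z x + T z y"
    by (rule LIMSEQ_unique[OF E_tendsto[OF z]]) (simp add: E_simps tendsto_add E_tendsto z)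
  show "T z (c *\<^sub>C x) = c *\<^sub>C T z x"
    by (rule LIMSEQ_unique[OF E_tendsto[OF z]]) (simp add: E_simps tendsto_scaleC E_tendsto z)
qed (simp add: norm_T_le z)

lemmas T_linear = bounded_clinear_simps[OF bounded_clinear_T]

lemma norm_T_diff_le:
  assumes z: "z \<in> S" and "x \<in> D"
  shows "norm (T z x - x) \<le> cmod z * norm (A x)"
  by (rule LIMSEQ_le_const2[OF tendsto_norm[OF tendsto_diff[OF E_tendsto[OF z] tendsto_const]]])
    (simp add: norm_E_diff_le assms)

lemma norm_T_diff_le2:
  assumes z: "z \<in> S" and "x \<in> D" "y \<in> D"
  shows "norm (T z x - x + z *\<^sub>C A x) \<le> 2 * cmod z * norm (A x - y) + (cmod z)\<^sup>2 * norm (A y)"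
  by (rule LIMSEQ_le_const2[OF tendsto_norm[OF tendsto_add[OF tendsto_diff[OF E_tendsto[OF z]]]]])
    (auto simp: norm_E_diff_le2 assms)

text \<open>Consistency and stability: J(z/n) J(w/n) and J((z+w)/n) have the same first-order
  expansion, so they differ by O(1/n^2) at x. Since all factors are commuting contractions, n steps
  accumulate at most O(1/n).\<close>

lemma T_add_square_domain:
  assumes z: "z \<in> S" and w: "w \<in> S" and x: "x \<in> D" "A x \<in> D"
  shows "T (z + w) x = T z (T w x)"
proof -
  define B where "B = norm (A (A x))"
  define K where "K = ((cmod w)\<^sup>2 + (cmod z)\<^sup>2 + cmod w * cmod z + (cmod (z + w))\<^sup>2) * B"
  have local: "norm (J (z / n) (J (w / n) x) - J ((z + w) / n) x) \<le> K / (real n)\<^sup>2"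
    if n: "0 < n" for n :: nat
  proof -
    define z' w' where "z' = z / of_nat n" and "w' = w / of_nat n"
    have S: "z' \<in> S" "w' \<in> S" "z' + w' \<in> S"
      using z w n by (auto simp: z'_def w'_def intro: S_divide S_add)
    have est: "norm (J v x - x + v *\<^sub>C A x) \<le> (cmod v)\<^sup>2 * B" if "v \<in> S" for v
      using norm_Jpow_diff_le2[OF that x, of 1] by (simp add: B_def)
    have J1: "norm (J z' (J w' x - x + w' *\<^sub>C A x)) \<le> (cmod w')\<^sup>2 * B"
      by (rule order_trans[OF norm_J_le[OF S(1)] est[OF S(2)]])
    have J2: "norm (w' *\<^sub>C (J z' (A x) - A x)) \<le> cmod w' * (cmod z' * B)"
      unfolding norm_scaleC using norm_Jpow_diff_le[OF S(1) x(2), of 1]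
      by (intro mult_left_mono) (auto simp: B_def)
    \<comment> \<open>Expanding \<open>J w'\<close> inside \<open>J z'\<close> leaves w' J z' (A x),
      in which \<open>J z'\<close> has to be replaced by the identity. This mixed term is of second
      order because A x is in D.\<close>
    have "J z' (J w' x) - J (z' + w') x = J z' (J w' x - x + w' *\<^sub>C A x) + (J z' x - x + z' *\<^sub>C A x)
        - w' *\<^sub>C (J z' (A x) - A x) - (J (z' + w') x - x + (z' + w') *\<^sub>C A x)"
      using S by (simp add: J_linear scaleC_add_left complex_vector.scale_right_diff_distrib)
    also have "norm \<dots> \<le> (cmod w')\<^sup>2 * B + (cmod z')\<^sup>2 * B + cmod w' * (cmod z' * B) + (cmod (z' + w'))\<^sup>2 * B"
      by (intro order_trans[OF norm_triangle_ineq4] order_trans[OF norm_triangle_ineq] add_mono J1 J2 est S)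
    also have "\<dots> = K / (real n)\<^sup>2"
    proof -
      have "cmod z' = cmod z / real n" "cmod w' = cmod w / real n" "cmod (z' + w') = cmod (z + w) / real n"
        by (auto simp: z'_def w'_def norm_divide simp flip: add_divide_distrib)
      then show ?thesis
        by (simp only: K_def power_divide) (simp add: power2_eq_square add_divide_distrib distrib_right)
    qed
    finally show ?thesis
      by (simp add: z'_def w'_def add_divide_distrib)
  qed
  have main: "norm (E n z (E n w x) - E n (z + w) x) \<le> K / real n" if n: "0 < n" for n
  proof -
    have S: "z / n \<in> S" "w / n \<in> S" "(z + w) / n \<in> S"
      using z w n by (auto intro: S_divide S_add)
    have "E n z (E n w x) = ((\<lambda>x. J (z / n) (J (w / n) x)) ^^ n) x"
      unfolding E_def by (rule sym, rule funpow_comp_commute[of "J (z / n)" "J (w / n)"], rule J_commute[OF S(1,2)])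
    then have "norm (E n z (E n w x) - E n (z + w) x)
        \<le> real n * norm (J (z / n) (J (w / n) x) - J ((z + w) / n) x)"
      unfolding E_def using S
      by (auto intro!: norm_funpow_diff_le J_nonexpansive simp: J_commute intro: order_trans[OF J_nonexpansive])
    also have "\<dots> \<le> real n * (K / (real n)\<^sup>2)"
      by (intro mult_left_mono local n) auto
    finally show ?thesis
      using n by (simp add: power2_eq_square)
  qed
  have "(\<lambda>n. E (Suc n) z (E (Suc n) w x) - E (Suc n) (z + w) x) \<longlonglongrightarrow> 0"
  proof (rule LIMSEQ_zero_norm_le)
    have "(\<lambda>n. K * inverse (real (Suc n))) \<longlonglongrightarrow> K * 0"
      by (intro tendsto_intros LIMSEQ_inverse_real_of_nat)
    then show "(\<lambda>n. K / real (Suc n)) \<longlonglongrightarrow> 0"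
      by (simp add: divide_inverse)
  qed (intro main zero_less_Suc)
  \<comment> \<open>The inner limit may be taken although the outer operator also varies with n,
    because the outer operators are contractions.\<close>
  moreover have "(\<lambda>n. E (Suc n) z (E (Suc n) w x) - E (Suc n) z (T w x)) \<longlonglongrightarrow> 0"
  proof (rule LIMSEQ_zero_norm_le)
    have "(\<lambda>n. norm (E (Suc n) w x - T w x)) \<longlonglongrightarrow> norm (T w x - T w x)"
      by (intro tendsto_intros E_tendsto w)
    then show "(\<lambda>n. norm (E (Suc n) w x - T w x)) \<longlonglongrightarrow> 0"
      by simp
    show "norm (E (Suc n) z (E (Suc n) w x) - E (Suc n) z (T w x)) \<le> norm (E (Suc n) w x - T w x)" for n
      using norm_E_le[OF z zero_less_Suc]
      by (simp flip: bounded_clinear_simps(2)[OF bounded_clinear_E[OF z zero_less_Suc]])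
  qed
  ultimately have "(\<lambda>n. (E (Suc n) z (E (Suc n) w x) - E (Suc n) z (T w x))
      - (E (Suc n) z (E (Suc n) w x) - E (Suc n) (z + w) x) + E (Suc n) z (T w x))
      \<longlonglongrightarrow> 0 - 0 + T z (T w x)"
    by (intro tendsto_intros E_tendsto z)
  then have "(\<lambda>n. E (Suc n) (z + w) x) \<longlonglongrightarrow> T z (T w x)"
    by simp
  then show ?thesis
    using E_tendsto[OF S_add[OF z w]] LIMSEQ_unique by blast
qed

lemma T_add:
  assumes z: "z \<in> S" and w: "w \<in> S"
  shows "T (z + w) x = T z (T w x)"
proof -
  have bl: "bounded_linear (T v)" if "v \<in> S" for v
    using bounded_clinear_T[OF that] by (simp add: bounded_clinear_def)
  have "closed {x. T (z + w) x = T z (T w x)}"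
    by (intro closed_Collect_eq linear_continuous_on bl S_add z w bounded_linear_compose[OF bl bl])
  moreover have "{x \<in> D. A x \<in> D} \<subseteq> {x. T (z + w) x = T z (T w x)}"
    using T_add_square_domain[OF z w] by auto
  ultimately have "closure {x \<in> D. A x \<in> D} \<subseteq> {x. T (z + w) x = T z (T w x)}"
    by (rule closure_minimal[rotated])
  then show ?thesis
    using dense_domain_square by auto
qed

section \<open>Holomorphy of the semigroup\<close>

lemma Jpow_derivative:
  assumes z: "z \<in> S"
  shows "\<exists>F. ((\<lambda>w. (1 / (w - z)) *\<^sub>C ((J w ^^ k) x - (J z ^^ k) x)) \<longlongrightarrow> F) (at z)"
proof (induction k)
  case 0
  then show ?case by auto
next
  case (Suc k)
  define Q where "Q w = (1 / (w - z)) *\<^sub>C ((J w ^^ k) x - (J z ^^ k) x)" for w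
  define q where "q w = Q w - A (J z ((J z ^^ k) x))" for w
  obtain F where "(Q \<longlongrightarrow> F) (at z)"
    using Suc unfolding Q_def[abs_def] by blast
  then have "(q \<longlongrightarrow> F - A (J z ((J z ^^ k) x))) (at z)"
    unfolding q_def[abs_def] by (intro tendsto_diff tendsto_const)
  then obtain q0 where q0: "(q \<longlongrightarrow> q0) (at z)"
    by blast
  have ev: "\<forall>\<^sub>F w in at z. w \<in> S \<and> w \<noteq> z"
    using open_S z by (simp add: eventually_at_in_open' eventually_conj eventually_neq_at_within)
  \<comment> \<open>Product rule. By the resolvent identity the increment of the outer factor is J w
    applied to a multiple of a vector that does not depend on w, so the whole quotient is
    \<open>J w (q w)\<close>. As q has a limit and J w is contractive and strongly continuous at z,
    this tends to \<open>J z q0\<close>.\<close>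
  have eq: "(1 / (w - z)) *\<^sub>C ((J w ^^ Suc k) x - (J z ^^ Suc k) x) = J w (q w)"
    if w: "w \<in> S \<and> w \<noteq> z" for w
  proof -
    have "(J w ^^ Suc k) x - (J z ^^ Suc k) x
        = J w ((J w ^^ k) x - (J z ^^ k) x) + (J w ((J z ^^ k) x) - J z ((J z ^^ k) x))"
      using w by (simp add: J_linear)
    also have "\<dots> = J w ((J w ^^ k) x - (J z ^^ k) x) - (w - z) *\<^sub>C J w (A (J z ((J z ^^ k) x)))"
      using w z by (simp add: J_resolvent complex_vector.scale_left_diff_distrib)
    finally have eq: "(J w ^^ Suc k) x - (J z ^^ Suc k) x
        = J w ((J w ^^ k) x - (J z ^^ k) x) - (w - z) *\<^sub>C J w (A (J z ((J z ^^ k) x)))" .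
    show ?thesis
      unfolding eq q_def Q_def using w by (simp add: J_linear complex_vector.scale_right_diff_distrib)
  qed
  have "((\<lambda>w. J w (q w) - J z q0) \<longlongrightarrow> 0) (at z)"
  proof (rule Lim_null_comparison[rotated])
    have "((\<lambda>w. norm (q w - q0) + cmod (z - w) * norm (A (J z q0)))
        \<longlongrightarrow> norm (q0 - q0) + cmod (z - z) * norm (A (J z q0))) (at z)"
      by (intro tendsto_intros q0)
    then show "((\<lambda>w. norm (q w - q0) + cmod (z - w) * norm (A (J z q0))) \<longlongrightarrow> 0) (at z)"
      by simp
    show "\<forall>\<^sub>F w in at z. norm (J w (q w) - J z q0) \<le> norm (q w - q0) + cmod (z - w) * norm (A (J z q0))"
      using ev
    proof eventually_elim
      case (elim w)
      then have w: "w \<in> S" by simp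
      have "norm (J w q0 - J z q0) \<le> cmod (z - w) * norm (A (J z q0))"
        unfolding J_resolvent[OF z w] norm_scaleC by (intro mult_left_mono norm_J_le w) auto
      then show ?case
        using J_nonexpansive[OF w, of "q w" q0] norm_triangle_ineq[of "J w (q w) - J w q0" "J w q0 - J z q0"]
        by simp
    qed
  qed
  then have "((\<lambda>w. J w (q w)) \<longlongrightarrow> J z q0) (at z)"
    by (rule Lim_null[THEN iffD2])
  then have "((\<lambda>w. (1 / (w - z)) *\<^sub>C ((J w ^^ Suc k) x - (J z ^^ Suc k) x)) \<longlongrightarrow> J z q0) (at z)"
    by (rule Lim_transform_eventually) (use ev eq in \<open>auto elim!: eventually_mono\<close>)
  then show ?case
    by blast
qed

lemma holomorphic_Jpow: "(\<lambda>z. cinner ((J z ^^ k) x) y) holomorphic_on S"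
  unfolding holomorphic_on_open[OF open_S]
proof
  fix z assume "z \<in> S"
  then obtain F where "((\<lambda>w. (1 / (w - z)) *\<^sub>C ((J w ^^ k) x - (J z ^^ k) x)) \<longlongrightarrow> F) (at z)"
    using Jpow_derivative by blast
  then have "((\<lambda>w. cinner ((1 / (w - z)) *\<^sub>C ((J w ^^ k) x - (J z ^^ k) x)) y) \<longlongrightarrow> cinner F y) (at z)"
    by (intro tendsto_intros)
  then show "\<exists>f'. ((\<lambda>z. cinner ((J z ^^ k) x) y) has_field_derivative f') (at z)"
    by (auto simp: has_field_derivative_iff cinner.form_simps)
qed

lemma holomorphic_T: "(\<lambda>z. cinner (T z x) y) holomorphic_on S"
proof (rule holomorphic_uniform_sequence[OF open_S])
  show "(\<lambda>z. cinner (E (Suc n) z x) y) holomorphic_on S" for n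
  proof -
    have "(\<lambda>z. cinner ((J z ^^ Suc n) x) y) \<circ> (\<lambda>z. z / of_nat (Suc n)) holomorphic_on S"
      by (rule holomorphic_on_compose_gen[OF _ holomorphic_Jpow])
        (auto intro!: holomorphic_intros S_divide simp del: of_nat_Suc)
    then show ?thesis
      by (simp add: comp_def E_def)
  qed
  fix z assume "z \<in> S"
  then obtain r where r: "0 < r" "cball z r \<subseteq> S"
    using open_S open_contains_cball by blast
  have "cball z r \<subseteq> S \<inter> cball 0 (cmod z + r)"
  proof
    fix w assume "w \<in> cball z r"
    then show "w \<in> S \<inter> cball 0 (cmod z + r)"
      using r norm_triangle_sub[of w z] by (auto simp: dist_norm norm_minus_commute)
  qed
  then have "uniform_limit (cball z r) (\<lambda>n z. E (Suc n) z x) (\<lambda>z. T z x) sequentially"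
    by (rule uniform_limit_on_subset[OF uniform_limit_E])
  then have "uniform_limit (cball z r) (\<lambda>n z. cinner (E (Suc n) z x) y) (\<lambda>z. cinner (T z x) y) sequentially"
    by (rule bounded_linear.uniform_limit[OF
      bounded_bilinear.bounded_linear_left[OF bounded_bilinear_cinner]])
  with r show "\<exists>d>0. cball z d \<subseteq> S \<and>
      uniform_limit (cball z d) (\<lambda>n z. cinner (E (Suc n) z x) y) (\<lambda>z. cinner (T z x) y) sequentially"
    by blast
qed

end

text \<open>Product rule at t = 0. Used with \<gamma> and with -\<gamma>, it shows that the original
  and the rescaled semigroup are differentiable at the same vectors, as the equivalence in
  \<open>is_generator\<close> demands.\<close>

lemma exp_scale_difference_quotient:
  fixes f :: "real \<Rightarrow> 'h::complex_hilbert_space"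
  assumes "((\<lambda>t. (1 / t) *\<^sub>R (f t - x)) \<longlongrightarrow> y) (at_right 0)"
  shows "((\<lambda>t. (1 / t) *\<^sub>R (complex_of_real (exp (c * t)) *\<^sub>C f t - x)) \<longlongrightarrow> y + c *\<^sub>R x) (at_right 0)"
proof -
  have "((\<lambda>t. exp (c * t)) has_real_derivative c) (at 0 within {0<..})"
    by (rule DERIV_subset) (auto intro!: derivative_eq_intros)
  then have "((\<lambda>t. (1 / t) * (exp (c * t) - 1)) \<longlongrightarrow> c) (at_right 0)"
    by (simp add: has_field_derivative_iff)
  moreover have "((\<lambda>t. exp (c * t)) \<longlongrightarrow> exp (c * 0)) (at_right 0)"
    by (intro tendsto_intros)
  ultimately have "((\<lambda>t. exp (c * t) *\<^sub>R ((1 / t) *\<^sub>R (f t - x)) + ((1 / t) * (exp (c * t) - 1)) *\<^sub>R x)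
      \<longlongrightarrow> exp (c * 0) *\<^sub>R y + c *\<^sub>R x) (at_right 0)"
    by (intro tendsto_intros assms)
  moreover have "exp (c * t) *\<^sub>R ((1 / t) *\<^sub>R (f t - x)) + ((1 / t) * (exp (c * t) - 1)) *\<^sub>R x
      = (1 / t) *\<^sub>R (complex_of_real (exp (c * t)) *\<^sub>C f t - x)" for t
    by (simp add: algebra_simps flip: scaleR_eq_scaleC)
  ultimately show ?thesis
    by simp
qed

section \<open>The generator and the behaviour at the origin\<close>

context accretive_operator
begin

lemma T_tendsto: "((\<lambda>z. T z x) \<longlongrightarrow> x) (at 0 within S)"
proof (rule tendstoI)
  fix e :: real assume e: "0 < e"
  have "x \<in> closure D"
    using dense by simp
  then obtain y where y: "y \<in> D" "dist y x < e / 3"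
    unfolding closure_approachable using e by (metis zero_less_divide_iff zero_less_numeral)
  have "((\<lambda>z. cmod z * norm (A y)) \<longlongrightarrow> cmod 0 * norm (A y)) (at 0 within S)"
    by (intro tendsto_intros)
  then have "\<forall>\<^sub>F z in at 0 within S. cmod z * norm (A y) < e / 3"
    using e by (intro order_tendstoD) auto
  moreover have "\<forall>\<^sub>F z in at 0 within S. z \<in> S"
    by (simp add: eventually_at_filter)
  ultimately show "\<forall>\<^sub>F z in at 0 within S. dist (T z x) x < e"
  proof eventually_elim
    case (elim z)
    have "T z x - x = T z (x - y) + (T z y - y) - (x - y)"
      using elim by (simp add: T_linear)
    also have "norm \<dots> \<le> norm (x - y) + norm (T z y - y) + norm (x - y)"
      by (rule order_trans[OF norm_triangle_ineq4] add_mono order_refl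
          order_trans[OF norm_triangle_ineq] norm_T_le elim)+
    also have "\<dots> < e"
      using norm_T_diff_le[OF elim(2) y(1)] y(2) elim(1) by (simp add: dist_norm norm_minus_commute)
    finally show ?case
      by (simp add: dist_norm)
  qed
qed

lemma T_right_derivative:
  assumes x: "x \<in> D"
  shows "((\<lambda>t. (1 / t) *\<^sub>R (T (complex_of_real t) x - x)) \<longlongrightarrow> - A x) (at_right 0)"
proof (rule tendstoI)
  fix e :: real assume e: "0 < e"
  have "A x \<in> closure D"
    using dense by simp
  \<comment> \<open>y is fixed before t: the estimate divided by t is 2
    \<open>norm (A x - y)\<close> + t \<open>norm (A y)\<close>, and its first term does not shrink
    with t.\<close>
  then obtain y where y: "y \<in> D" "dist y (A x) < e / 4"
    unfolding closure_approachable using e by (metis zero_less_divide_iff zero_less_numeral)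
  have "((\<lambda>t. t * norm (A y)) \<longlongrightarrow> 0 * norm (A y)) (at_right 0)"
    by (intro tendsto_intros)
  then have "\<forall>\<^sub>F t in at_right 0. t * norm (A y) < e / 2"
    using e by (intro order_tendstoD) auto
  moreover have "\<forall>\<^sub>F t in at_right (0::real). 0 < t"
    by (simp add: eventually_at_filter)
  ultimately show "\<forall>\<^sub>F t in at_right 0. dist ((1 / t) *\<^sub>R (T (complex_of_real t) x - x)) (- A x) < e"
  proof eventually_elim
    case (elim t)
    have "(1 / t) *\<^sub>R (T (complex_of_real t) x - x) - (- A x)
        = (1 / t) *\<^sub>R (T (complex_of_real t) x - x + complex_of_real t *\<^sub>C A x)"
      using elim by (simp add: scaleR_add_right flip: scaleR_eq_scaleC)
    also have "norm \<dots> = (1 / t) * norm (T (complex_of_real t) x - x + complex_of_real t *\<^sub>C A x)"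
      using elim by simp
    also have "\<dots> \<le> (1 / t) * (2 * t * norm (A x - y) + t\<^sup>2 * norm (A y))"
      using norm_T_diff_le2[OF S_of_real[OF elim(2)] x y(1)] elim
      by (intro mult_left_mono) auto
    also have "\<dots> = 2 * norm (A x - y) + t * norm (A y)"
      using elim by (simp add: power2_eq_square field_simps)
    also have "\<dots> < e"
      using y(2) elim by (simp add: dist_norm norm_minus_commute)
    finally show ?case
      by (simp add: dist_norm)
  qed
qed

text \<open>
  The generator of the contraction semigroup has no eigenvector for the eigenvalue 1, so it
  cannot properly extend \<open>- A\<close>, because \<open>1 + A\<close> is onto.
\<close>

lemma is_generator_T: "is_generator D (\<lambda>x. - A x) (\<lambda>t. T (complex_of_real t))"
  unfolding is_generator_def
proof (intro allI iffI)
  fix x y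
  assume "x \<in> D \<and> - A x = y"
  then show "((\<lambda>t. (1 / t) *\<^sub>R (T (complex_of_real t) x - x)) \<longlongrightarrow> y) (at_right 0)"
    using T_right_derivative by blast
next
  fix x y
  assume lim: "((\<lambda>t. (1 / t) *\<^sub>R (T (complex_of_real t) x - x)) \<longlongrightarrow> y) (at_right 0)"
  \<comment> \<open>If B is the generator, so that B x = y, then x - y = (1 - B) x, and x' is the
    vector of D with (1 + A) x' = x - y. As B extends -A, the difference d satisfies B d =
    d.\<close>
  define x' where "x' = J 1 (x - y)"
  define d where "d = x - x'"
  have x': "x' \<in> D" "x' + A x' = x - y"
    using J_eq[OF one_in, of "x - y"] one_in by (auto simp: x'_def)
  define q where "q t = (1 / t) *\<^sub>R (T (complex_of_real t) d - d)" for t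
  have "((\<lambda>t. (1 / t) *\<^sub>R (T (complex_of_real t) x - x) - (1 / t) *\<^sub>R (T (complex_of_real t) x' - x'))
      \<longlongrightarrow> y - (- A x')) (at_right 0)"
    by (intro tendsto_diff lim T_right_derivative x')
  moreover have "y - (- A x') = d"
    using x'(2) by (simp add: d_def algebra_simps)
  moreover have pos: "\<forall>\<^sub>F t in at_right (0::real). 0 < t"
    by (simp add: eventually_at_filter)
  then have "\<forall>\<^sub>F t in at_right (0::real). (1 / t) *\<^sub>R (T (complex_of_real t) x - x)
      - (1 / t) *\<^sub>R (T (complex_of_real t) x' - x') = q t"
  proof eventually_elim
    case (elim t)
    then show ?case
      by (simp add: q_def d_def T_linear S_of_real algebra_simps)
  qed
  ultimately have "(q \<longlongrightarrow> d) (at_right 0)"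
    by (auto intro: Lim_transform_eventually)
  then have "((\<lambda>t. norm (q t - d)) \<longlongrightarrow> norm (d - d)) (at_right 0)"
    by (intro tendsto_intros)
  moreover from pos have "\<forall>\<^sub>F t in at_right (0::real). norm d \<le> norm (q t - d)"
  proof eventually_elim
    case (elim t)
    \<comment> \<open>Once q t is close to d, T t d is close to (1 + t) d, which is too long for a
      contraction unless d = 0.\<close>
    have "(1 + t) *\<^sub>R d = T (complex_of_real t) d - t *\<^sub>R (q t - d)"
      using elim by (simp add: q_def algebra_simps)
    then have "(1 + t) * norm d \<le> norm d + t * norm (q t - d)"
      using elim norm_triangle_ineq4[of "T (complex_of_real t) d" "t *\<^sub>R (q t - d)"]
        norm_T_le[OF S_of_real[OF elim], of d] norm_scaleR[of "1 + t" d] norm_scaleR[of t "q t - d"]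
      by simp
    then have "t * norm d \<le> t * norm (q t - d)"
      by (simp add: algebra_simps)
    then show ?case
      using elim by simp
  qed
  ultimately have "norm d \<le> norm (d - d)"
    by (rule tendsto_lowerbound) simp
  then have "x = x'"
    by (simp add: d_def)
  then show "x \<in> D \<and> - A x = y"
    using x' by (metis add_diff_cancel_left' diff_minus_eq_add minus_diff_eq uminus_add_conv_diff)
qed

lemma generates_holomorphic_C0_semigroup:
  assumes S: "S = interior (sector \<phi>)"
    and sector: "\<And>\<psi>. 0 \<le> \<psi> \<Longrightarrow> \<psi> < \<phi> \<Longrightarrow> sector \<psi> \<subseteq> insert 0 S"
  shows "generates_holomorphic_C0_semigroup \<phi> D (\<lambda>x. - (A x + complex_of_real \<gamma> *\<^sub>C x))"
proof -
  \<comment> \<open>The exponential factor adds \<gamma> to A. The value at 0 is set separately,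
    because 0 is not in S and nothing is known about \<open>T 0\<close>.\<close>
  define U where "U z = (if z = 0 then id else (\<lambda>x. exp (- (complex_of_real \<gamma> * z)) *\<^sub>C T z x))" for z
  have U: "U z x = exp (- (complex_of_real \<gamma> * z)) *\<^sub>C T z x" if "z \<in> S" for z x
    using that zero_notin by (auto simp: U_def)
  have "operator_holomorphic_on U S"
  proof (rule operator_holomorphic_onI)
    show "bounded_clinear (U z)" if z: "z \<in> S" for z
    proof (rule bounded_clinearI)
      show "norm (U z x) \<le> cmod (exp (- (complex_of_real \<gamma> * z))) * norm x" for x
        using z by (simp add: U norm_scaleC mult_left_mono norm_T_le del: norm_exp_eq_Re)
    qed (use z in \<open>simp_all add: U T_linear complex_vector.scale_right_distrib mult.commute\<close>)
    have "(\<lambda>z. exp (- (complex_of_real \<gamma> * z)) * cinner (T z x) y) holomorphic_on S" for x y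
      by (intro holomorphic_intros holomorphic_T)
    then show "(\<lambda>z. cinner (U z x) y) holomorphic_on S" for x y
      by (rule holomorphic_transform) (simp add: U cinner_scaleC_left)
    fix z assume "z \<in> S"
    then obtain r where r: "0 < r" "ball z r \<subseteq> S"
      using open_S open_contains_ball by blast
    have "norm (U w x) \<le> exp (\<bar>\<gamma>\<bar> * (cmod z + r)) * norm x" if w: "w \<in> ball z r" for w x
    proof -
      have "cmod (\<gamma> * w) \<le> \<bar>\<gamma>\<bar> * (cmod z + r)"
        using w norm_triangle_sub[of w z] unfolding norm_mult
        by (intro mult_mono) (auto simp: dist_norm norm_minus_commute)
      then have "cmod (exp (- (complex_of_real \<gamma> * w))) \<le> exp (\<bar>\<gamma>\<bar> * (cmod z + r))"
        using complex_Re_le_cmod[of "- (complex_of_real \<gamma> * w)"] by (simp only: norm_exp_eq_Re exp_le_cancel_iff norm_minus_cancel)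
      moreover have "w \<in> S"
        using w r by blast
      ultimately show ?thesis
        unfolding U[OF \<open>w \<in> S\<close>] norm_scaleC by (intro mult_mono norm_T_le) auto
    qed
    with r show "\<exists>r>0. \<exists>M\<ge>0. ball z r \<subseteq> S \<and> (\<forall>w\<in>ball z r. \<forall>x. norm (U w x) \<le> M * norm x)"
      by (intro exI[of _ r] exI[of _ "exp (\<bar>\<gamma>\<bar> * (cmod z + r))"] conjI) auto
  qed
  moreover have "U 0 = id"
    by (simp add: U_def)
  moreover have "U (z + w) = U z \<circ> U w" if "z \<in> insert 0 S" "w \<in> insert 0 S" for z w
  proof (cases "z = 0 \<or> w = 0")
    case True
    then show ?thesis by (auto simp: U_def)
  next
    case False
    with that have "z \<in> S" "w \<in> S" "z + w \<in> S"
      by (auto intro: S_add)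
    moreover have "exp (- (complex_of_real \<gamma> * (z + w)))
        = exp (- (complex_of_real \<gamma> * z)) * exp (- (complex_of_real \<gamma> * w))"
      by (simp add: algebra_simps flip: exp_add)
    ultimately show ?thesis
      by (intro ext) (simp add: U T_add T_linear)
  qed
  moreover have "((\<lambda>z. U z x) \<longlongrightarrow> x) (at 0 within sector \<psi>)" if \<psi>: "0 \<le> \<psi>" "\<psi> < \<phi>" for \<psi> x
  proof -
    have "((\<lambda>z. exp (- (complex_of_real \<gamma> * z)) *\<^sub>C T z x)
        \<longlongrightarrow> exp (- (complex_of_real \<gamma> * 0)) *\<^sub>C x) (at 0 within S)"
      by (intro tendsto_intros T_tendsto)
    then have "((\<lambda>z. exp (- (complex_of_real \<gamma> * z)) *\<^sub>C T z x) \<longlongrightarrow> x) (at 0 within S)"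
      by simp
    then have "((\<lambda>z. U z x) \<longlongrightarrow> x) (at 0 within S)"
      by (rule Lim_transform_eventually) (simp add: eventually_at_filter U)
    then have "((\<lambda>z. U z x) \<longlongrightarrow> x) (at 0 within insert 0 S)"
      by (simp add: at_within_def)
    then show ?thesis
      by (rule tendsto_within_subset) (rule sector[OF \<psi>])
  qed
  ultimately have "holomorphic_C0_semigroup \<phi> U"
    by (auto simp: holomorphic_C0_semigroup_def S)
  moreover have "is_generator D (\<lambda>x. - (A x + complex_of_real \<gamma> *\<^sub>C x)) (\<lambda>t. U (complex_of_real t))"
    unfolding is_generator_def
  proof (intro allI)
    fix x y
    have pos: "\<forall>\<^sub>F t in at_right (0::real). 0 < t"
      by (simp add: eventually_at_filter)
    have "((\<lambda>t. (1 / t) *\<^sub>R (U (complex_of_real t) x - x)) \<longlongrightarrow> y) (at_right 0)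
      \<longleftrightarrow> ((\<lambda>t. (1 / t) *\<^sub>R (complex_of_real (exp (- \<gamma> * t)) *\<^sub>C T (complex_of_real t) x - x)) \<longlongrightarrow> y) (at_right 0)"
      using pos by (intro tendsto_cong, elim eventually_mono) (simp add: U S_of_real exp_of_real flip: of_real_mult of_real_minus)
    also have "\<dots> \<longleftrightarrow> ((\<lambda>t. (1 / t) *\<^sub>R (T (complex_of_real t) x - x)) \<longlongrightarrow> y + \<gamma> *\<^sub>R x) (at_right 0)"
    proof
      assume "((\<lambda>t. (1 / t) *\<^sub>R (complex_of_real (exp (- \<gamma> * t)) *\<^sub>C T (complex_of_real t) x - x)) \<longlongrightarrow> y) (at_right 0)"
      from exp_scale_difference_quotient[OF this, of \<gamma>]
      show "((\<lambda>t. (1 / t) *\<^sub>R (T (complex_of_real t) x - x)) \<longlongrightarrow> y + \<gamma> *\<^sub>R x) (at_right 0)"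
        by (simp add: scaleC_scaleC flip: of_real_mult exp_add)
    next
      assume "((\<lambda>t. (1 / t) *\<^sub>R (T (complex_of_real t) x - x)) \<longlongrightarrow> y + \<gamma> *\<^sub>R x) (at_right 0)"
      from exp_scale_difference_quotient[OF this, of "- \<gamma>"]
      show "((\<lambda>t. (1 / t) *\<^sub>R (complex_of_real (exp (- \<gamma> * t)) *\<^sub>C T (complex_of_real t) x - x)) \<longlongrightarrow> y) (at_right 0)"
        by simp
    qed
    also have "\<dots> \<longleftrightarrow> x \<in> D \<and> - A x = y + \<gamma> *\<^sub>R x"
      using is_generator_T unfolding is_generator_def by blast
    also have "- A x = y + \<gamma> *\<^sub>R x \<longleftrightarrow> - (A x + complex_of_real \<gamma> *\<^sub>C x) = y"
      by (auto simp: algebra_simps simp flip: scaleR_eq_scaleC)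
    finally show "x \<in> D \<and> - (A x + complex_of_real \<gamma> *\<^sub>C x) = y \<longleftrightarrow>
        ((\<lambda>t. (1 / t) *\<^sub>R (U (complex_of_real t) x - x)) \<longlongrightarrow> y) (at_right 0)"
      by blast
  qed
  ultimately show ?thesis
    unfolding generates_holomorphic_C0_semigroup_def by blast
qed

end

section \<open>Sectors\<close>

text \<open>For z of modulus r and argument \<alpha> the second inequality says r sin (\<phi> -
  |\<alpha>|) \<ge> 0. In Cartesian form the sector is visibly a convex cone. The end \<phi> = pi/2
  is included because \<theta> may be 0.\<close>

lemma sector_iff:
  assumes "0 \<le> \<phi>" "\<phi> \<le> pi / 2"
  shows "z \<in> sector \<phi> \<longleftrightarrow> 0 \<le> Re z \<and> \<bar>Im z\<bar> * cos \<phi> \<le> Re z * sin \<phi>"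
proof
  assume "z \<in> sector \<phi>"
  then obtain r \<alpha> where z: "z = rcis r \<alpha>" and r: "0 \<le> r" and \<alpha>: "\<bar>\<alpha>\<bar> \<le> \<phi>"
    by (auto simp: sector_def)
  have "0 \<le> cos \<alpha>"
    using \<alpha> assms by (intro cos_ge_zero) auto
  moreover have "\<bar>sin \<alpha>\<bar> * cos \<phi> \<le> cos \<alpha> * sin \<phi>"
  proof -
    have "0 \<le> sin (\<phi> - \<bar>\<alpha>\<bar>)"
      using \<alpha> assms by (intro sin_ge_zero) auto
    moreover have "\<bar>sin \<alpha>\<bar> = sin \<bar>\<alpha>\<bar>"
      using \<alpha> assms sin_ge_zero[of "\<bar>\<alpha>\<bar>"] by (cases "0 \<le> \<alpha>") auto
    ultimately show ?thesis
      by (simp add: sin_diff mult.commute)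
  qed
  ultimately show "0 \<le> Re z \<and> \<bar>Im z\<bar> * cos \<phi> \<le> Re z * sin \<phi>"
    using r mult_left_mono[of "\<bar>sin \<alpha>\<bar> * cos \<phi>" "cos \<alpha> * sin \<phi>" r]
    by (simp add: z abs_mult mult.assoc)
next
  assume *: "0 \<le> Re z \<and> \<bar>Im z\<bar> * cos \<phi> \<le> Re z * sin \<phi>"
  define \<alpha> where "\<alpha> = Arg z"
  have z: "z = rcis (cmod z) \<alpha>"
    by (simp add: \<alpha>_def rcis_cmod_Arg)
  show "z \<in> sector \<phi>"
  proof (cases "z = 0")
    case True
    then show ?thesis
      using assms by (auto simp: sector_def intro!: exI[of _ 0])
  next
    case False
    then have r: "0 < cmod z"
      by simp
    have \<alpha>: "- pi < \<alpha>" "\<alpha> \<le> pi"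
      using Arg_bounded[of z] by (auto simp: \<alpha>_def)
    have Re: "Re z = cmod z * cos \<alpha>" and Im: "Im z = cmod z * sin \<alpha>"
      by (metis z Re_rcis, metis z Im_rcis)
    then have "0 \<le> cos \<alpha>"
      using * r by (simp add: zero_le_mult_iff)
    have \<alpha>2: "\<bar>\<alpha>\<bar> \<le> pi / 2"
    proof (rule ccontr)
      assume "\<not> \<bar>\<alpha>\<bar> \<le> pi / 2"
      then have "0 < cos (pi - \<bar>\<alpha>\<bar>)"
        using \<alpha> by (intro cos_gt_zero_pi) auto
      then show False
        using \<open>0 \<le> cos \<alpha>\<close> by simp
    qed
    have "cmod z * (\<bar>sin \<alpha>\<bar> * cos \<phi>) \<le> cmod z * (cos \<alpha> * sin \<phi>)"
      using * unfolding Re Im by (simp add: abs_mult mult.assoc)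
    then have "\<bar>sin \<alpha>\<bar> * cos \<phi> \<le> cos \<alpha> * sin \<phi>"
      using r by simp
    moreover have "\<bar>sin \<alpha>\<bar> = sin \<bar>\<alpha>\<bar>"
      using \<alpha> sin_ge_zero[of "\<bar>\<alpha>\<bar>"] by (cases "0 \<le> \<alpha>") auto
    ultimately have "0 \<le> sin (\<phi> - \<bar>\<alpha>\<bar>)"
      by (simp add: sin_diff mult.commute)
    then have "\<bar>\<alpha>\<bar> \<le> \<phi>"
      using sin_gt_zero[of "\<bar>\<alpha>\<bar> - \<phi>"] sin_minus[of "\<phi> - \<bar>\<alpha>\<bar>"] \<alpha>2 assms
      by (cases "\<bar>\<alpha>\<bar> \<le> \<phi>") auto
    then show ?thesis
      using z unfolding sector_def by (metis (mono_tags, lifting) mem_Collect_eq norm_ge_zero)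
  qed
qed

lemma sector_add:
  assumes "0 \<le> \<phi>" "\<phi> \<le> pi / 2" "z \<in> sector \<phi>" "w \<in> sector \<phi>"
  shows "z + w \<in> sector \<phi>"
proof -
  have "\<bar>Im z + Im w\<bar> * cos \<phi> \<le> (\<bar>Im z\<bar> + \<bar>Im w\<bar>) * cos \<phi>"
    using assms by (intro mult_right_mono cos_ge_zero) auto
  then show ?thesis
    using assms by (simp add: sector_iff distrib_right)
qed

lemma sector_scale:
  assumes "0 \<le> t" "z \<in> sector \<phi>"
  shows "complex_of_real t * z \<in> sector \<phi>"
proof -
  obtain r \<alpha> where "z = rcis r \<alpha>" "0 \<le> r" "\<bar>\<alpha>\<bar> \<le> \<phi>"
    using assms(2) by (auto simp: sector_def)
  moreover have "complex_of_real t * rcis r \<alpha> = rcis (t * r) \<alpha>"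
    by (simp add: rcis_def)
  ultimately show ?thesis
    using assms(1) unfolding sector_def mem_Collect_eq
    by (intro exI[of _ "t * r"] exI[of _ \<alpha>]) simp
qed

text \<open>The translate of the interior by z is an open subset of the sector, hence contained in
  the interior.\<close>

lemma interior_sector_add:
  assumes "0 \<le> \<phi>" "\<phi> \<le> pi / 2" "z \<in> interior (sector \<phi>)" "w \<in> interior (sector \<phi>)"
  shows "z + w \<in> interior (sector \<phi>)"
proof -
  have "(+) z ` interior (sector \<phi>) \<subseteq> interior (sector \<phi>)"
  proof (rule interior_maximal)
    show "(+) z ` interior (sector \<phi>) \<subseteq> sector \<phi>"
      using assms sector_add interior_subset by blast
  qed (simp add: open_translation)
  then show ?thesis
    using assms(4) by blast
qed

lemma interior_sector_scale:
  assumes "0 < t" "z \<in> interior (sector \<phi>)"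
  shows "complex_of_real t * z \<in> interior (sector \<phi>)"
proof -
  have "(*\<^sub>R) t ` interior (sector \<phi>) \<subseteq> interior (sector \<phi>)"
  proof (rule interior_maximal)
    show "(*\<^sub>R) t ` interior (sector \<phi>) \<subseteq> sector \<phi>"
      using assms(1) sector_scale[of t _ \<phi>] interior_subset[of "sector \<phi>"]
      by (auto simp: scaleR_conv_of_real)
  qed (use assms in \<open>simp add: open_scaling\<close>)
  then show ?thesis
    using assms(2) by (auto simp: scaleR_conv_of_real)
qed

text \<open>The strict forms of the inequalities in \<open>sector_iff\<close> cut out an open set,
  and the rays of angle at most \<psi> lie in it since sin (\<phi> - |\<alpha>|) > 0. This turns
  convergence within S into continuity at 0 in the smaller closed sectors.\<close>

lemma sector_subset_insert_interior:
  assumes "0 \<le> \<psi>" "\<psi> < \<phi>" "\<phi> \<le> pi / 2"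
  shows "sector \<psi> \<subseteq> insert 0 (interior (sector \<phi>))"
proof
  fix z assume "z \<in> sector \<psi>"
  then obtain r \<alpha> where z: "z = rcis r \<alpha>" and r: "0 \<le> r" and \<alpha>: "\<bar>\<alpha>\<bar> \<le> \<psi>"
    by (auto simp: sector_def)
  let ?U = "{z. 0 < Re z \<and> \<bar>Im z\<bar> * cos \<phi> < Re z * sin \<phi>}"
  have "open ?U"
    by (intro open_Collect_conj open_Collect_less continuous_intros)
  moreover have "?U \<subseteq> sector \<phi>"
    using assms by (auto simp: sector_iff)
  ultimately have U: "?U \<subseteq> interior (sector \<phi>)"
    by (simp add: interior_maximal)
  show "z \<in> insert 0 (interior (sector \<phi>))"
  proof (cases "r = 0")
    case False
    with r have r: "0 < r"
      by simp
    have "0 < cos \<alpha>"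
      using \<alpha> assms by (intro cos_gt_zero_pi) auto
    moreover have "\<bar>sin \<alpha>\<bar> * cos \<phi> < cos \<alpha> * sin \<phi>"
    proof -
      have "0 < sin (\<phi> - \<bar>\<alpha>\<bar>)"
        using \<alpha> assms by (intro sin_gt_zero) auto
      moreover have "\<bar>sin \<alpha>\<bar> = sin \<bar>\<alpha>\<bar>"
        using \<alpha> assms sin_ge_zero[of "\<bar>\<alpha>\<bar>"] by (cases "0 \<le> \<alpha>") auto
      ultimately show ?thesis
        by (simp add: sin_diff mult.commute)
    qed
    then have "r * (\<bar>sin \<alpha>\<bar> * cos \<phi>) < r * (cos \<alpha> * sin \<phi>)"
      using r by simp
    ultimately have "z \<in> ?U"
      using r by (simp add: z abs_mult mult.assoc)
    with U show ?thesis
      by blast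
  qed (simp add: z)
qed

lemma one_in_interior_sector:
  assumes "0 < \<phi>" "\<phi> \<le> pi / 2"
  shows "1 \<in> interior (sector \<phi>)"
proof -
  have "1 \<in> sector 0"
    by (auto simp: sector_def intro!: exI[of _ 1])
  then show ?thesis
    using sector_subset_insert_interior[of 0 \<phi>] assms by auto
qed

text \<open>The room between z and the boundary is the source of the coercivity constant.\<close>

lemma interior_sector_minus_of_real:
  assumes "z \<in> interior (sector \<phi>)"
  obtains \<epsilon> where "0 < \<epsilon>" "z - complex_of_real \<epsilon> \<in> sector \<phi>"
proof -
  obtain e where e: "0 < e" "cball z e \<subseteq> sector \<phi>"
    using assms by (auto simp: mem_interior_cball)
  moreover have "z - complex_of_real e \<in> cball z e"
    using e by (simp add: dist_norm)
  ultimately show ?thesis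
    using that by blast
qed

lemma zero_notin_interior_sector:
  assumes "0 \<le> \<phi>" "\<phi> \<le> pi / 2"
  shows "0 \<notin> interior (sector \<phi>)"
proof
  assume "0 \<in> interior (sector \<phi>)"
  then obtain \<epsilon> where "0 < \<epsilon>" "0 - complex_of_real \<epsilon> \<in> sector \<phi>"
    by (rule interior_sector_minus_of_real)
  then show False
    using assms by (simp add: sector_iff)
qed

text \<open>The arguments add up to at most pi/2 in modulus. This complementarity is where the
  half-angle pi/2 - \<theta> of the semigroup comes from.\<close>

lemma Re_mult_sector_nonneg:
  assumes "w \<in> sector (pi / 2 - \<theta>)" "b \<in> sector \<theta>"
  shows "0 \<le> Re (w * b)"
proof -
  obtain r \<alpha> where w: "w = rcis r \<alpha>" "0 \<le> r" "\<bar>\<alpha>\<bar> \<le> pi / 2 - \<theta>"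
    using assms(1) by (auto simp: sector_def)
  obtain s \<beta> where b: "b = rcis s \<beta>" "0 \<le> s" "\<bar>\<beta>\<bar> \<le> \<theta>"
    using assms(2) by (auto simp: sector_def)
  have "0 \<le> cos (\<alpha> + \<beta>)"
    using w(3) b(3) by (intro cos_ge_zero) auto
  then show ?thesis
    using w b by (simp add: rcis_mult)
qed

lemma cmod_sector_le:
  assumes "0 \<le> \<theta>" "\<theta> < pi / 2" "b \<in> sector \<theta>"
  shows "cmod b \<le> Re b / cos \<theta>" "0 \<le> Re b"
proof -
  obtain r \<alpha> where b: "b = rcis r \<alpha>" "0 \<le> r" "\<bar>\<alpha>\<bar> \<le> \<theta>"
    using assms(3) by (auto simp: sector_def)
  have "cos \<theta> \<le> cos \<bar>\<alpha>\<bar>"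
    using b assms by (intro cos_monotone_0_pi_le) auto
  then have cos: "cos \<theta> \<le> cos \<alpha>"
    by simp
  have pos: "0 < cos \<theta>"
    using assms by (intro cos_gt_zero_pi) auto
  show "cmod b \<le> Re b / cos \<theta>"
    using mult_left_mono[OF cos b(2)] pos b by (simp add: le_divide_eq)
  show "0 \<le> Re b"
    using b pos cos by simp
qed

section \<open>The operator associated with a sectorial form\<close>

text \<open>The graph of the future operator, kept as a relation until it is known to be
  single-valued.\<close>

definition form_relation ::
  "'h::complex_hilbert_space set \<Rightarrow> ('h \<Rightarrow> 'h \<Rightarrow> complex) \<Rightarrow> 'h \<Rightarrow> 'h \<Rightarrow> bool" where
  "form_relation V a x f \<longleftrightarrow>
     (\<exists>u :: nat \<Rightarrow> 'h. (\<forall>n. u n \<in> V) \<and> bounded (range (\<lambda>n. Re (a (u n) (u n)))) \<and>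
        u \<longlonglongrightarrow> x \<and> (\<forall>v\<in>V. (\<lambda>n. a (u n) v) \<longlonglongrightarrow> cinner f v))"

text \<open>The bound on the real parts survives because u_n converges in H, so \<gamma> times its
  squared norm stays bounded. Applied with \<gamma> and -\<gamma>, this one implication gives an
  equivalence.\<close>

lemma form_relation_shift:
  fixes a :: "'h::complex_hilbert_space \<Rightarrow> 'h \<Rightarrow> complex"
  assumes "form_relation V a x f"
  shows "form_relation V (\<lambda>u v. a u v + complex_of_real \<gamma> * cinner u v) x (f + complex_of_real \<gamma> *\<^sub>C x)"
proof -
  obtain u where u: "\<And>n. u n \<in> V" "bounded (range (\<lambda>n. Re (a (u n) (u n))))" "u \<longlonglongrightarrow> x"
    "\<And>v. v \<in> V \<Longrightarrow> (\<lambda>n. a (u n) v) \<longlonglongrightarrow> cinner f v"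
    using assms unfolding form_relation_def by blast
  have "(\<lambda>n. \<gamma> * (norm (u n))\<^sup>2) \<longlonglongrightarrow> \<gamma> * (norm x)\<^sup>2"
    by (intro tendsto_intros u)
  then have "bounded (range (\<lambda>n. Re (a (u n) (u n)) + \<gamma> * (norm (u n))\<^sup>2))"
    by (intro bounded_plus_comp u convergent_imp_bounded)
  moreover have "(\<lambda>n. a (u n) v + complex_of_real \<gamma> * cinner (u n) v)
      \<longlonglongrightarrow> cinner f v + complex_of_real \<gamma> * cinner x v" if "v \<in> V" for v
    using that by (intro tendsto_intros u)
  ultimately show ?thesis
    unfolding form_relation_def using u
    by (intro exI[of _ u]) (auto simp: cinner_self cinner_add_left cinner_scaleC_left)
qed

locale sectorial_form = sesquilinear_form V a
  for V :: "'h::complex_hilbert_space set" and a +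
  fixes \<theta> :: real
  assumes dense: "closure V = UNIV"
    and \<theta>: "0 \<le> \<theta>" "\<theta> < pi / 2"
    and sectorial: "u \<in> V \<Longrightarrow> a u u \<in> sector \<theta>"
begin

abbreviation S :: "complex set" where
  "S \<equiv> interior (sector (pi / 2 - \<theta>))"

text \<open>The Hermitian part of a plus the inner product, so that \<open>h.fnorm\<close> is the
  norm N of the overview. The second summand makes it dominate the norm of H.\<close>

definition h :: "'h \<Rightarrow> 'h \<Rightarrow> complex" where
  "h u v = (a u v + cnj (a v u)) / 2 + cinner u v"

sublocale h: positive_form V h
proof
  show "sesquilinear_on V h"
    by (auto simp: sesquilinear_on_def h_def form_simps cinner.form_simps field_simps)
  show "h u v = cnj (h v u)" for u v
    using cinner_commute[of u v] by (simp add: h_def)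
  show "0 \<le> Re (h u u)" if "u \<in> V" for u
    using cmod_sector_le(2)[OF \<theta> sectorial[OF that]] by (simp add: h_def cinner_self del: of_real_power)
qed (rule subspace)

lemma fnorm_sq: "u \<in> V \<Longrightarrow> (h.fnorm u)\<^sup>2 = Re (a u u) + (norm u)\<^sup>2"
  by (simp add: h.fnorm_sq) (simp add: h_def cinner_self del: of_real_power)

lemma Re_nonneg: "u \<in> V \<Longrightarrow> 0 \<le> Re (a u u)"
  using cmod_sector_le(2)[OF \<theta> sectorial] .

lemma norm_le_fnorm: "u \<in> V \<Longrightarrow> norm u \<le> h.fnorm u"
  by (rule power2_le_imp_le) (simp_all add: fnorm_sq Re_nonneg)

text \<open>Polarization and the sector condition bound a(u, v) by a sum of squares; normalising u
  and v turns the sum into a product, at the price of the factor 2.\<close>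

lemma form_bound:
  assumes u: "u \<in> V" and v: "v \<in> V"
  shows "cmod (a u v) \<le> 2 / cos \<theta> * (h.fnorm u * h.fnorm v)"
proof -
  have pos: "0 < cos \<theta>"
    using \<theta> by (intro cos_gt_zero_pi) auto
  have sum: "cmod (a u v) \<le> ((h.fnorm u)\<^sup>2 + (h.fnorm v)\<^sup>2) / cos \<theta>" if u: "u \<in> V" and v: "v \<in> V" for u v
  proof -
    have bd: "cmod (a w w) \<le> Re (a w w) / cos \<theta>" if "w \<in> V" for w
      using cmod_sector_le(1)[OF \<theta> sectorial[OF that]] .
    \<comment> \<open>With this the last two terms of the polarization also pair by the
      parallelogram law, to the same value 2 a(u, u) + 2 a(v, v).\<close>
    have iv: "a (\<i> *\<^sub>C v) (\<i> *\<^sub>C v) = a v v"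
      using v by (simp add: scale_left scale_right)
    have "cmod (4 * a u v) \<le> cmod (a (u + v) (u + v)) + cmod (a (u - v) (u - v))
        + cmod (\<i> * a (u + \<i> *\<^sub>C v) (u + \<i> *\<^sub>C v)) + cmod (\<i> * a (u - \<i> *\<^sub>C v) (u - \<i> *\<^sub>C v))"
      unfolding polarization[OF u v]
      by (intro order_trans[OF norm_triangle_ineq4] order_trans[OF norm_triangle_ineq] add_mono order_refl)
    also have "\<dots> \<le> Re (a (u + v) (u + v)) / cos \<theta> + Re (a (u - v) (u - v)) / cos \<theta>
        + Re (a (u + \<i> *\<^sub>C v) (u + \<i> *\<^sub>C v)) / cos \<theta> + Re (a (u - \<i> *\<^sub>C v) (u - \<i> *\<^sub>C v)) / cos \<theta>"
      unfolding norm_mult norm_ii mult_1 using u v by (intro add_mono bd) auto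
    also have "\<dots> = Re (a (u + v) (u + v) + a (u - v) (u - v)
        + (a (u + \<i> *\<^sub>C v) (u + \<i> *\<^sub>C v) + a (u - \<i> *\<^sub>C v) (u - \<i> *\<^sub>C v))) / cos \<theta>"
      by (simp add: add_divide_distrib)
    also have "\<dots> = (4 * (Re (a u u) + Re (a v v))) / cos \<theta>"
      using u v by (simp only: parallelogram scale_mem iv) simp
    finally have "cmod (a u v) \<le> (Re (a u u) + Re (a v v)) / cos \<theta>"
      using pos by (simp add: norm_mult le_divide_eq)
    also have "\<dots> \<le> ((h.fnorm u)\<^sup>2 + (h.fnorm v)\<^sup>2) / cos \<theta>"
      using pos u v by (intro divide_right_mono) (auto simp: fnorm_sq)
    finally show ?thesis .
  qed
  show ?thesis
  proof (cases "h.fnorm u = 0 \<or> h.fnorm v = 0")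
    case True
    then have "u = 0 \<or> v = 0"
      using norm_le_fnorm[OF u] norm_le_fnorm[OF v] by auto
    then have "a u v = 0"
      using u v scale_right[of u v 0] scale_left[of u v 0] by auto
    then show ?thesis
      using True by auto
  next
    case False
    define s where "s = h.fnorm u"
    define t where "t = h.fnorm v"
    have st: "0 < s" "0 < t"
      using False h.fnorm_nonneg[OF u] h.fnorm_nonneg[OF v] by (auto simp: s_def t_def)
    let ?u = "complex_of_real (1 / s) *\<^sub>C u" and ?v = "complex_of_real (1 / t) *\<^sub>C v"
    have "cmod (a ?u ?v) \<le> ((h.fnorm ?u)\<^sup>2 + (h.fnorm ?v)\<^sup>2) / cos \<theta>"
      using u v by (intro sum scale_mem)
    moreover have "h.fnorm ?u = 1" "h.fnorm ?v = 1"
      unfolding h.fnorm_scale[OF u] h.fnorm_scale[OF v]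
      using st by (simp_all add: norm_divide flip: s_def t_def)
    moreover have "cmod (a ?u ?v) = cmod (a u v) / (s * t)"
      using u v st by (simp add: scale_left scale_right norm_mult norm_divide)
    ultimately have "cmod (a u v) / (s * t) \<le> 2 / cos \<theta>"
      by simp
    then show ?thesis
      using st by (simp add: divide_le_eq flip: s_def t_def)
  qed
qed

definition c :: "complex \<Rightarrow> 'h \<Rightarrow> 'h \<Rightarrow> complex" where
  "c z u v = cinner u v + z * a u v"

text \<open>Since z - \<epsilon> is still in the sector, Re (z a(u)) \<ge> \<epsilon> Re a(u); the
  inner product contributes the squared norm with factor 1, whence \<delta> = min 1 \<epsilon>. The
  adjoint form has the same bound and the same real part on the diagonal. The form itself serves
  solvability, its adjoint injectivity.\<close>

lemma coercive:
  assumes z: "z \<in> S"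
  obtains M \<delta> where "coercive_form V h (c z) M \<delta>" "coercive_form V h (\<lambda>u v. cnj (c z v u)) M \<delta>"
proof -
  obtain \<epsilon> where \<epsilon>: "0 < \<epsilon>" "z - complex_of_real \<epsilon> \<in> sector (pi / 2 - \<theta>)"
    using z by (rule interior_sector_minus_of_real)
  define M where "M = 1 + cmod z * (2 / cos \<theta>)"
  define \<delta> where "\<delta> = min 1 \<epsilon>"
  have pos: "0 < cos \<theta>"
    using \<theta> by (intro cos_gt_zero_pi) auto
  have \<delta>: "0 < \<delta>" "\<delta> \<le> M"
    using \<epsilon> pos by (auto simp: \<delta>_def M_def intro: order_trans[of _ 1])
  have sesq: "sesquilinear_on V (c z)"
    by (auto simp: sesquilinear_on_def c_def form_simps cinner.form_simps algebra_simps)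
  then have sesq': "sesquilinear_on V (\<lambda>u v. cnj (c z v u))"
    unfolding sesquilinear_on_def by simp
  have bd: "cmod (c z u v) \<le> M * h.fnorm u * h.fnorm v" if u: "u \<in> V" and v: "v \<in> V" for u v
  proof -
    have "cmod (c z u v) \<le> cmod (cinner u v) + cmod z * cmod (a u v)"
      unfolding c_def norm_mult[symmetric] by (rule norm_triangle_ineq)
    also have "\<dots> \<le> h.fnorm u * h.fnorm v + cmod z * (2 / cos \<theta> * (h.fnorm u * h.fnorm v))"
    proof (intro add_mono mult_left_mono form_bound u v)
      have "norm u * norm v \<le> h.fnorm u * h.fnorm v"
        using u v by (intro mult_mono norm_le_fnorm) auto
      then show "cmod (cinner u v) \<le> h.fnorm u * h.fnorm v"
        using cinner_Cauchy_Schwarz[of u v] by linarith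
    qed simp
    also have "\<dots> = M * h.fnorm u * h.fnorm v"
      by (simp add: M_def algebra_simps)
    finally show ?thesis .
  qed
  have co: "\<delta> * (h.fnorm u)\<^sup>2 \<le> Re (c z u u)" if u: "u \<in> V" for u
  proof -
    have "0 \<le> Re ((z - complex_of_real \<epsilon>) * a u u)"
      using \<epsilon>(2) sectorial[OF u] by (rule Re_mult_sector_nonneg)
    then have "\<epsilon> * Re (a u u) \<le> Re (z * a u u)"
      by (simp add: left_diff_distrib)
    moreover have "\<delta> * Re (a u u) \<le> \<epsilon> * Re (a u u)" "\<delta> * (norm u)\<^sup>2 \<le> 1 * (norm u)\<^sup>2"
      using Re_nonneg[OF u] by (intro mult_right_mono; simp add: \<delta>_def)+
    ultimately show ?thesis
      using u by (simp add: fnorm_sq c_def cinner_self distrib_left del: of_real_power times_complex.simps)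
  qed
  have bd': "cmod (cnj (c z v u)) \<le> M * h.fnorm u * h.fnorm v" if "u \<in> V" "v \<in> V" for u v
    using bd[OF that(2,1)] by (simp add: mult.commute mult.left_commute)
  have "coercive_form V h (c z) M \<delta>"
    by unfold_locales (use \<delta> sesq bd co subspace in auto)
  moreover have "coercive_form V h (\<lambda>u v. cnj (c z v u)) M \<delta>"
    by unfold_locales (use \<delta> sesq' bd' co subspace in auto)
  ultimately show ?thesis
    using that by blast
qed

text \<open>Bounded real parts are not visibly preserved by sums of sequences, whereas bounds on
  \<open>h.fnorm\<close> are, by the triangle inequality. This lemma and the next translate between
  the two.\<close>

lemma fnorm_bounded:
  assumes u: "\<And>n. u n \<in> V" and "bounded (range (\<lambda>n. Re (a (u n) (u n))))" and "u \<longlonglongrightarrow> x"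
  obtains B where "0 < B" "\<And>n. h.fnorm (u n) \<le> B"
proof -
  obtain B1 where B1: "\<And>n. Re (a (u n) (u n)) \<le> B1"
    using assms(2) by (auto simp: bounded_iff abs_le_iff)
  have "bounded (range u)"
    using assms(3) by (rule convergent_imp_bounded)
  then obtain B2 where B2: "\<And>n. norm (u n) \<le> B2"
    by (auto simp: bounded_iff)
  \<comment> \<open>The summand 1 makes \<open>B\<close> positive, so that it can be divided by
    later.\<close>
  define B where "B = sqrt (B1 + B2\<^sup>2) + 1"
  have fb: "h.fnorm (u n) \<le> sqrt (B1 + B2\<^sup>2)" for n
  proof (rule real_le_rsqrt)
    show "(h.fnorm (u n))\<^sup>2 \<le> B1 + B2\<^sup>2"
      unfolding fnorm_sq[OF u] by (intro add_mono B1 power_mono B2) auto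
  qed
  have "0 < B"
    using order_trans[OF h.fnorm_nonneg[OF u] fb] unfolding B_def by linarith
  moreover have "h.fnorm (u n) \<le> B" for n
    using fb[of n] by (simp add: B_def)
  ultimately show ?thesis
    using that by blast
qed

lemma bounded_if_fnorm_le:
  assumes u: "\<And>n. u n \<in> V" and "\<And>n. h.fnorm (u n) \<le> B"
  shows "bounded (range (\<lambda>n. Re (a (u n) (u n))))"
proof -
  have "\<bar>Re (a (u n) (u n))\<bar> \<le> B\<^sup>2" for n
    using power_mono[OF assms(2) h.fnorm_nonneg[OF u], of n 2] Re_nonneg[OF u, of n]
    by (simp add: fnorm_sq[OF u]) (smt (verit) zero_le_power2)
  then show ?thesis
    by (auto simp: bounded_iff)
qed

lemma form_relation_linear:
  assumes "form_relation V a x f" "form_relation V a y g"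
  shows "form_relation V a (x + s *\<^sub>C y) (f + s *\<^sub>C g)"
proof -
  obtain u where u: "\<And>n. u n \<in> V" "bounded (range (\<lambda>n. Re (a (u n) (u n))))" "u \<longlonglongrightarrow> x"
    "\<And>v. v \<in> V \<Longrightarrow> (\<lambda>n. a (u n) v) \<longlonglongrightarrow> cinner f v"
    using assms(1) unfolding form_relation_def by blast
  obtain w where w: "\<And>n. w n \<in> V" "bounded (range (\<lambda>n. Re (a (w n) (w n))))" "w \<longlonglongrightarrow> y"
    "\<And>v. v \<in> V \<Longrightarrow> (\<lambda>n. a (w n) v) \<longlonglongrightarrow> cinner g v"
    using assms(2) unfolding form_relation_def by blast
  obtain B1 where B1: "\<And>n. h.fnorm (u n) \<le> B1"
    using fnorm_bounded[OF u(1-3)] by blast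
  obtain B2 where B2: "\<And>n. h.fnorm (w n) \<le> B2"
    using fnorm_bounded[OF w(1-3)] by blast
  have "h.fnorm (u n + s *\<^sub>C w n) \<le> B1 + cmod s * B2" for n
    using h.fnorm_triangle[OF u(1) scale_mem[OF w(1)], of n s n] h.fnorm_scale[OF w(1), of s n]
      B1[of n] mult_left_mono[OF B2[of n], of "cmod s"] by simp
  then have "bounded (range (\<lambda>n. Re (a (u n + s *\<^sub>C w n) (u n + s *\<^sub>C w n))))"
    using u(1) w(1) by (intro bounded_if_fnorm_le) auto
  moreover have "(\<lambda>n. u n + s *\<^sub>C w n) \<longlonglongrightarrow> x + s *\<^sub>C y"
    by (intro tendsto_intros u w)
  moreover have "(\<lambda>n. a (u n + s *\<^sub>C w n) v) \<longlonglongrightarrow> cinner (f + s *\<^sub>C g) v" if v: "v \<in> V" for v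
  proof -
    have "(\<lambda>n. a (u n) v + s * a (w n) v) \<longlonglongrightarrow> cinner f v + s * cinner g v"
      by (intro tendsto_intros u w v)
    then show ?thesis
      using u(1) w(1) v by (simp add: form_simps cinner.form_simps)
  qed
  ultimately show ?thesis
    unfolding form_relation_def using u(1) w(1)
    by (intro exI[of _ "\<lambda>n. u n + s *\<^sub>C w n"]) auto
qed

lemma form_relation_zero: "form_relation V a 0 0"
  unfolding form_relation_def
  by (intro exI[of _ "\<lambda>_. 0"]) (use scale_left[of 0 _ 0] in \<open>auto simp: cinner.form_simps\<close>)

lemma form_relation_diff:
  "form_relation V a x f \<Longrightarrow> form_relation V a y g \<Longrightarrow> form_relation V a (x - y) (f - g)"
  using form_relation_linear[of x f y g "- 1"] by simp

text \<open>Approximate solutions with dual error 1/(n+1) are compared by testing their difference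
  with itself; coercivity then makes them Cauchy. The two additional conclusions record what an
  arbitrary sequence witnessing the relation does not provide: the inequality gives accretivity, the
  implication gives uniqueness of the value and density of the domain.\<close>

lemma form_relation_solvable:
  assumes z: "z \<in> S"
  obtains x f where "form_relation V a x f" "x + z *\<^sub>C f = g" "(norm x)\<^sup>2 \<le> Re (cinner g x)"
    "x = 0 \<Longrightarrow> g = 0"
proof -
  obtain M \<delta> where "coercive_form V h (c z) M \<delta>"
    using coercive[OF z] by blast
  then interpret C: coercive_form V h "c z" M \<delta> .
  have "\<exists>u\<in>V. \<forall>v\<in>V. cmod (cinner g v - c z u v) \<le> inverse (real (Suc n)) * h.fnorm v" for n
  proof -
    have al: "antilinear_on V (cinner g)"
      by (simp add: antilinear_on_def cinner.form_simps)
    have bd: "cmod (cinner g v) \<le> norm g * h.fnorm v" if "v \<in> V" for v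
      using cinner_Cauchy_Schwarz[of g v] mult_left_mono[OF norm_le_fnorm[OF that], of "norm g"] by simp
    obtain u where "u \<in> V"
      "\<And>v. v \<in> V \<Longrightarrow> cmod (cinner g v - c z u v) \<le> inverse (real (Suc n)) * h.fnorm v"
      using C.approximate_Lax_Milgram[OF al bd, of "inverse (real (Suc n))"]
      by (auto simp del: of_nat_Suc)
    then show ?thesis
      by (intro bexI ballI)
  qed
  then obtain u where u: "\<And>n. u n \<in> V"
    and approx: "\<And>n v. v \<in> V \<Longrightarrow> cmod (cinner g v - c z (u n) v) \<le> inverse (real (Suc n)) * h.fnorm v"
    by metis
  have inv: "inverse (real (Suc n)) \<le> 1" for n
    by (simp add: inverse_le_1_iff)
  have fb: "h.fnorm (u n) \<le> (norm g + 1) / \<delta>" for n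
  proof -
    have "\<delta> * (h.fnorm (u n))\<^sup>2 \<le> cmod (c z (u n) (u n))"
      using C.coercive[OF u] complex_Re_le_cmod by (rule order_trans)
    also have "\<dots> \<le> cmod (cinner g (u n)) + cmod (cinner g (u n) - c z (u n) (u n))"
      using norm_triangle_ineq4[of "cinner g (u n)" "cinner g (u n) - c z (u n) (u n)"] by simp
    also have "\<dots> \<le> norm g * h.fnorm (u n) + 1 * h.fnorm (u n)"
    proof (rule add_mono)
      show "cmod (cinner g (u n)) \<le> norm g * h.fnorm (u n)"
        using cinner_Cauchy_Schwarz[of g "u n"] mult_left_mono[OF norm_le_fnorm[OF u], of "norm g" n] by simp
      show "cmod (cinner g (u n) - c z (u n) (u n)) \<le> 1 * h.fnorm (u n)"
        using approx[OF u, of n n] mult_right_mono[OF inv h.fnorm_nonneg[OF u], of n n] by linarith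
    qed
    finally have "(\<delta> * h.fnorm (u n)) * h.fnorm (u n) \<le> (norm g + 1) * h.fnorm (u n)"
      by (simp add: power2_eq_square distrib_right mult.assoc)
    then have "\<delta> * h.fnorm (u n) \<le> norm g + 1"
      using h.fnorm_nonneg[OF u, of n] by (cases "h.fnorm (u n) = 0") (auto intro: mult_right_le_imp_le)
    then show ?thesis
      using C.\<delta> by (simp add: le_divide_eq mult.commute)
  qed
  have cauchy: "norm (u m - u n) \<le> (inverse (real (Suc m)) + inverse (real (Suc n))) / \<delta>" for m n
  proof -
    define d where "d = u m - u n"
    have d: "d \<in> V"
      using u by (simp add: d_def)
    have "\<delta> * (h.fnorm d)\<^sup>2 \<le> cmod (c z d d)"
      using C.coercive[OF d] complex_Re_le_cmod by (rule order_trans)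
    also have "c z d d = (cinner g d - c z (u n) d) - (cinner g d - c z (u m) d)"
      using u d by (subst (1) d_def) (simp add: C.c.diff_left)
    also have "cmod \<dots> \<le> cmod (cinner g d - c z (u n) d) + cmod (cinner g d - c z (u m) d)"
      by (rule norm_triangle_ineq4)
    also have "\<dots> \<le> inverse (real (Suc n)) * h.fnorm d + inverse (real (Suc m)) * h.fnorm d"
      by (intro add_mono approx d)
    finally have "(\<delta> * h.fnorm d) * h.fnorm d \<le> (inverse (real (Suc m)) + inverse (real (Suc n))) * h.fnorm d"
      by (simp add: power2_eq_square distrib_right mult.assoc del: of_nat_Suc)
    then have "\<delta> * h.fnorm d \<le> inverse (real (Suc m)) + inverse (real (Suc n))"
      using h.fnorm_nonneg[OF d] by (cases "h.fnorm d = 0") (auto intro: mult_right_le_imp_le simp del: of_nat_Suc)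
    then have "h.fnorm d \<le> (inverse (real (Suc m)) + inverse (real (Suc n))) / \<delta>"
      using C.\<delta> by (simp add: le_divide_eq mult.commute)
    then show ?thesis
      using norm_le_fnorm[OF d] by (simp add: d_def)
  qed
  have inv_lim: "(\<lambda>n. inverse (real (Suc n))) \<longlonglongrightarrow> 0"
    by (rule LIMSEQ_inverse_real_of_nat)
  have "Cauchy u"
  proof (rule CauchyI)
    fix e :: real assume "0 < e"
    then have "0 < e * \<delta> / 2"
      using C.\<delta> by simp
    then obtain N where N: "inverse (real (Suc N)) < e * \<delta> / 2"
      using reals_Archimedean by blast
    have "norm (u m - u n) < e" if mn: "N \<le> m" "N \<le> n" for m n
    proof -
      have "inverse (real (Suc m)) \<le> inverse (real (Suc N))" "inverse (real (Suc n)) \<le> inverse (real (Suc N))"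
        using mn by (auto simp: le_imp_inverse_le)
      then have "inverse (real (Suc m)) + inverse (real (Suc n)) < e * \<delta>"
        using N by linarith
      then have "(inverse (real (Suc m)) + inverse (real (Suc n))) / \<delta> < e"
        using C.\<delta> by (simp add: divide_less_eq del: of_nat_Suc)
      then show ?thesis
        using cauchy[of m n] by linarith
    qed
    then show "\<exists>N. \<forall>m\<ge>N. \<forall>n\<ge>N. norm (u m - u n) < e"
      by blast
  qed
  then obtain x where x: "u \<longlonglongrightarrow> x"
    by (auto simp: Cauchy_convergent_iff convergent_def)
  have lim: "(\<lambda>n. c z (u n) v) \<longlonglongrightarrow> cinner g v" if v: "v \<in> V" for v
  proof -
    have "(\<lambda>n. inverse (real (Suc n)) * h.fnorm v) \<longlonglongrightarrow> 0"
      by (rule tendsto_mult_left_zero[OF inv_lim])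
    then have "(\<lambda>n. cinner g v - c z (u n) v) \<longlonglongrightarrow> 0"
      by (rule LIMSEQ_zero_norm_le) (rule approx[OF v])
    then have "(\<lambda>n. cinner g v - (cinner g v - c z (u n) v)) \<longlonglongrightarrow> cinner g v - 0"
      by (intro tendsto_intros)
    then show ?thesis
      by simp
  qed
  have z0: "z \<noteq> 0"
    using z zero_notin_interior_sector[of "pi / 2 - \<theta>"] \<theta> by auto
  define f where "f = (1 / z) *\<^sub>C (g - x)"
  have "(\<lambda>n. a (u n) v) \<longlonglongrightarrow> cinner f v" if v: "v \<in> V" for v
  proof -
    have "(\<lambda>n. (1 / z) * (c z (u n) v - cinner (u n) v)) \<longlonglongrightarrow> (1 / z) * (cinner g v - cinner x v)"
      by (intro tendsto_intros lim x v)
    then show ?thesis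
      using z0 by (simp add: c_def f_def cinner.form_simps)
  qed
  moreover have "bounded (range (\<lambda>n. Re (a (u n) (u n))))"
    using u fb by (rule bounded_if_fnorm_le)
  ultimately have rel: "form_relation V a x f"
    unfolding form_relation_def using u x by blast
  have xf: "x + z *\<^sub>C f = g"
    using z0 by (simp add: f_def)
  \<comment> \<open>The test vector may vary with n, because the error is measured in the dual norm
    and u_n is bounded for \<open>h.fnorm\<close>.\<close>
  have diag: "(\<lambda>n. c z (u n) (u n)) \<longlonglongrightarrow> cinner g x"
  proof -
    have "(\<lambda>n. inverse (real (Suc n)) * ((norm g + 1) / \<delta>)) \<longlonglongrightarrow> 0"
      by (rule tendsto_mult_left_zero[OF inv_lim])
    moreover have "cmod (cinner g (u n) - c z (u n) (u n)) \<le> inverse (real (Suc n)) * ((norm g + 1) / \<delta>)" for n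
      using approx[OF u, of n n] mult_left_mono[OF fb, of "inverse (real (Suc n))" n] by (simp del: of_nat_Suc)
    ultimately have "(\<lambda>n. cinner g (u n) - c z (u n) (u n)) \<longlonglongrightarrow> 0"
      by (rule LIMSEQ_zero_norm_le)
    then have "(\<lambda>n. cinner g (u n) - (cinner g (u n) - c z (u n) (u n))) \<longlonglongrightarrow> cinner g x - 0"
      by (intro tendsto_intros x)
    then show ?thesis
      by simp
  qed
  have Re_diag: "(\<lambda>n. Re (c z (u n) (u n))) \<longlonglongrightarrow> Re (cinner g x)"
    by (intro tendsto_intros diag)
  have "(norm x)\<^sup>2 \<le> Re (cinner g x)"
  proof (rule LIMSEQ_le)
    show "(\<lambda>n. (norm (u n))\<^sup>2) \<longlonglongrightarrow> (norm x)\<^sup>2"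
      by (intro tendsto_intros x)
    have "(norm (u n))\<^sup>2 \<le> Re (c z (u n) (u n))" for n
      using Re_mult_sector_nonneg[OF subsetD[OF interior_subset z] sectorial[OF u], of n]
      by (simp add: c_def cinner_self del: of_real_power times_complex.simps)
    then show "\<exists>N. \<forall>n\<ge>N. (norm (u n))\<^sup>2 \<le> Re (c z (u n) (u n))"
      by blast
  qed (rule Re_diag)
  \<comment> \<open>Convergence of u_n to 0 in H alone says nothing about
    \<open>h.fnorm (u n)\<close>, the form not being closable. But the diagonal values tend to (g,
    0) = 0, so coercivity gives convergence to 0 for \<open>h.fnorm\<close>, and the equation passes
    to the limit.\<close>
  moreover have "g = 0" if x0: "x = 0"
  proof (rule eq_zero_if_cinner_dense[OF dense])
    fix v assume v: "v \<in> V"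
    have "(\<lambda>n. Re (c z (u n) (u n)) / \<delta>) \<longlonglongrightarrow> Re (cinner g x) / \<delta>"
      using C.\<delta> by (intro tendsto_intros Re_diag) auto
    then have "(\<lambda>n. Re (c z (u n) (u n)) / \<delta>) \<longlonglongrightarrow> 0"
      using x0 cinner.form_simps(4)[of g 0 0] by simp
    moreover have "norm ((h.fnorm (u n))\<^sup>2) \<le> Re (c z (u n) (u n)) / \<delta>" for n
      using C.coercive[OF u, of n] C.\<delta> by (simp add: le_divide_eq mult.commute)
    ultimately have "(\<lambda>n. (h.fnorm (u n))\<^sup>2) \<longlonglongrightarrow> 0"
      by (rule LIMSEQ_zero_norm_le)
    then have "(\<lambda>n. sqrt ((h.fnorm (u n))\<^sup>2)) \<longlonglongrightarrow> sqrt 0"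
      by (rule tendsto_real_sqrt)
    then have "(\<lambda>n. h.fnorm (u n)) \<longlonglongrightarrow> 0"
      using u by simp
    then have "(\<lambda>n. M * h.fnorm (u n) * h.fnorm v) \<longlonglongrightarrow> 0"
      by (intro tendsto_mult_left_zero tendsto_mult_right_zero)
    then have "(\<lambda>n. c z (u n) v) \<longlonglongrightarrow> 0"
      by (rule LIMSEQ_zero_norm_le) (rule C.bound[OF u v])
    then show "cinner g v = 0"
      using lim[OF v] LIMSEQ_unique by blast
  qed
  ultimately show ?thesis
    using that rel xf by blast
qed

text \<open>
  The sequence witnessing \<open>form_relation\<close> is only bounded for \<open>h.fnorm\<close>; testing it against an
  approximate solution \<open>w\<close> of the adjoint problem with right-hand side \<open>x\<close> makes up for the missing
  strong convergence.
\<close>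

lemma form_relation_injective:
  assumes z: "z \<in> S" and rel: "form_relation V a x f" and eq: "x + z *\<^sub>C f = 0"
  shows "x = 0"
proof -
  obtain M \<delta> where "coercive_form V h (\<lambda>u v. cnj (c z v u)) M \<delta>"
    using coercive[OF z] by blast
  then interpret C: coercive_form V h "\<lambda>u v. cnj (c z v u)" M \<delta> .
  obtain u where u: "\<And>n. u n \<in> V" "bounded (range (\<lambda>n. Re (a (u n) (u n))))" "u \<longlonglongrightarrow> x"
    and lim: "\<And>v. v \<in> V \<Longrightarrow> (\<lambda>n. a (u n) v) \<longlonglongrightarrow> cinner f v"
    using rel unfolding form_relation_def by blast
  obtain B where B: "0 < B" "\<And>n. h.fnorm (u n) \<le> B"
    using fnorm_bounded[OF u] by blast
  have "(norm x)\<^sup>2 \<le> 0 + e" if e: "0 < e" for e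
  proof -
    have "antilinear_on V (cinner x)"
      by (simp add: antilinear_on_def cinner.form_simps)
    moreover have "cmod (cinner x v) \<le> norm x * h.fnorm v" if "v \<in> V" for v
      using cinner_Cauchy_Schwarz[of x v] mult_left_mono[OF norm_le_fnorm[OF that], of "norm x"] by simp
    \<comment> \<open>As \<open>h.fnorm (u n)\<close> is at most \<open>B\<close>, the tolerance e /
      B makes the error at u_n at most e for all n at once.\<close>
    ultimately obtain w where w: "w \<in> V"
      and approx: "\<And>v. v \<in> V \<Longrightarrow> cmod (cinner x v - cnj (c z v w)) \<le> (e / B) * h.fnorm v"
      using C.approximate_Lax_Milgram[of "cinner x" "norm x" "e / B"] e B by auto
    have bd: "cmod (cinner x (u n) - cnj (c z (u n) w)) \<le> e" for n
    proof -
      have "(e / B) * h.fnorm (u n) \<le> (e / B) * B"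
        using e B by (intro mult_left_mono) auto
      then show ?thesis
        using approx[OF u(1), of n] B by simp
    qed
    \<comment> \<open>Here w is fixed, so the weak convergence of a(u_n, .) suffices; the limit of
      the second term is the conjugate of (x + z f, w) = 0.\<close>
    have "(\<lambda>n. cinner x (u n) - cnj (cinner (u n) w + z * a (u n) w))
        \<longlonglongrightarrow> cinner x x - cnj (cinner x w + z * cinner f w)"
      by (intro tendsto_intros u lim w)
    moreover have "cinner x w + z * cinner f w = cinner (x + z *\<^sub>C f) w"
      by (simp add: cinner.form_simps)
    then have "cinner x w + z * cinner f w = 0"
      by (simp add: eq)
    ultimately have "(\<lambda>n. cinner x (u n) - cnj (c z (u n) w)) \<longlonglongrightarrow> cinner x x"
      by (simp add: c_def)
    then have "cmod (cinner x x) \<le> e"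
      by (intro Lim_bounded[OF tendsto_norm]) (use bd in auto)
    then show ?thesis
      by (simp add: cinner_self norm_power)
  qed
  then have "(norm x)\<^sup>2 \<le> 0"
    by (rule field_le_epsilon)
  then show ?thesis
    by simp
qed

lemma one_in_S: "1 \<in> S"
  using \<theta> by (intro one_in_interior_sector) auto

text \<open>The difference f - g is a value at 0. Solving y + k = f - g and subtracting this value
  from k gives a solution of the homogeneous equation with the same y, so y = 0 by injectivity; a
  problem whose solution is 0 has right-hand side 0.\<close>

lemma form_relation_unique:
  assumes "form_relation V a x f" "form_relation V a x g"
  shows "f = g"
proof -
  have rel: "form_relation V a 0 (f - g)"
    using form_relation_diff[OF assms] by simp
  obtain y k where y: "form_relation V a y k" "y + 1 *\<^sub>C k = f - g" "y = 0 \<Longrightarrow> f - g = 0"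
    using form_relation_solvable[OF one_in_S] by blast
  have "form_relation V a y (k - (f - g))"
    using form_relation_diff[OF y(1) rel] by simp
  moreover have "y + 1 *\<^sub>C (k - (f - g)) = 0"
    by (simp flip: y(2))
  ultimately have "y = 0"
    using form_relation_injective[OF one_in_S] by blast
  with y(3) show ?thesis
    by simp
qed

section \<open>The operator and its m-accretivity\<close>

definition D :: "'h set" where
  "D = {x. \<exists>f. form_relation V a x f}"

definition A :: "'h \<Rightarrow> 'h" where
  "A x = (THE f. form_relation V a x f)"

lemma form_relation_iff: "x \<in> D \<and> A x = f \<longleftrightarrow> form_relation V a x f"
  unfolding D_def A_def using form_relation_unique by (auto intro: theI the_equality)

lemma operator_in: "operator_in D A"
proof -
  have rel: "form_relation V a x (A x)" if "x \<in> D" for x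
    using that form_relation_iff by blast
  have lin: "x + s *\<^sub>C y \<in> D \<and> A (x + s *\<^sub>C y) = A x + s *\<^sub>C A y" if "x \<in> D" "y \<in> D" for x y s
    unfolding form_relation_iff using that by (intro form_relation_linear rel)
  have zero: "0 \<in> D \<and> A 0 = 0"
    unfolding form_relation_iff by (rule form_relation_zero)
  show ?thesis
    unfolding operator_in_def complex_vector.subspace_def
    using lin[of _ _ 1] lin[of 0] zero by simp
qed

text \<open>The estimate is known only for limits of approximate solutions. Injectivity identifies
  the given x with the limit belonging to the same right-hand side.\<close>

lemma accretive:
  assumes z: "z \<in> S" and x: "x \<in> D"
  shows "norm x \<le> norm (x + z *\<^sub>C A x)"
proof -
  define g where "g = x + z *\<^sub>C A x"
  obtain y f where y: "form_relation V a y f" "y + z *\<^sub>C f = g" "(norm y)\<^sup>2 \<le> Re (cinner g y)"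
    using form_relation_solvable[OF z] by blast
  have "form_relation V a (y - x) (f - A x)"
    using x form_relation_iff by (intro form_relation_diff y) blast
  moreover have "(y - x) + z *\<^sub>C (f - A x) = (y + z *\<^sub>C f) - (x + z *\<^sub>C A x)"
    by (simp add: complex_vector.scale_right_diff_distrib)
  then have "(y - x) + z *\<^sub>C (f - A x) = 0"
    by (simp add: y(2) g_def)
  ultimately have "y - x = 0"
    by (rule form_relation_injective[OF z])
  then have "(norm x)\<^sup>2 \<le> Re (cinner g x)"
    using y(3) by simp
  also have "\<dots> \<le> norm g * norm x"
    using complex_Re_le_cmod cinner_Cauchy_Schwarz by (rule order_trans)
  finally show ?thesis
    unfolding g_def[symmetric]
    by (cases "x = 0") (auto simp: power2_eq_square intro: mult_right_le_imp_le)
qed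

text \<open>A vector orthogonal to D vanishes: taking it as right-hand side at z = 1, the solution x
  is in D, so the inequality in \<open>form_relation_solvable\<close> gives x = 0, and then the
  right-hand side is 0 too. This is applied to f minus its projection to the closure of D.\<close>

lemma dense_domain: "closure D = UNIV"
proof -
  have "f \<in> closure D" for f
  proof -
    have sub: "complex_vector.subspace D"
      using operator_in by (simp add: operator_in_def)
    \<comment> \<open>Approximate Riesz representatives of (f, .) within D converge to the
      orthogonal projection of f onto the closure of D.\<close>
    interpret D: positive_form D cinner
    proof
      show "cinner u v = cnj (cinner v u)" for u v :: 'h
        by (rule cinner_commute)
    qed (use sub in \<open>auto simp: sesquilinear_on_def cinner.form_simps cinner_self simp del: of_real_power\<close>)
    have "\<exists>w\<in>D. \<forall>v\<in>D. cmod (cinner f v - cinner w v) \<le> inverse (real (Suc n)) * norm v" for n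
    proof -
      have "antilinear_on D (cinner f)"
        by (simp add: antilinear_on_def cinner.form_simps)
      moreover have "cmod (cinner f v) \<le> norm f * positive_form.fnorm cinner v" for v
        by (simp add: cinner_Cauchy_Schwarz)
      moreover have "0 < inverse (real (Suc n))"
        by simp
      ultimately obtain w where "w \<in> D"
        "\<And>v. v \<in> D \<Longrightarrow> cmod (cinner f v - cinner w v) \<le> inverse (real (Suc n)) * positive_form.fnorm cinner v"
        by (rule D.approximate_Riesz[OF _ _ _ norm_ge_zero]) (rule that)
      then show ?thesis
        unfolding fnorm_cinner by (intro bexI ballI)
    qed
    then obtain w where w: "\<And>n. w n \<in> D"
      and approx: "\<And>n v. v \<in> D \<Longrightarrow> cmod (cinner (f - w n) v) \<le> inverse (real (Suc n)) * norm v"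
      unfolding cinner.diff_left[OF UNIV_I UNIV_I UNIV_I, symmetric] by metis
    have cauchy: "norm (w m - w n) \<le> inverse (real (Suc m)) + inverse (real (Suc n))" for m n
    proof -
      define d where "d = w m - w n"
      have d: "d \<in> D"
        using w by (simp add: d_def)
      have "norm d * norm d = cmod (cinner d d)"
        by (simp add: cinner_self norm_power power2_eq_square norm_mult)
      also have "cinner d d = cinner (f - w n) d - cinner (f - w m) d"
        by (simp add: d_def cinner.diff_left)
      also have "cmod \<dots> \<le> cmod (cinner (f - w n) d) + cmod (cinner (f - w m) d)"
        by (rule norm_triangle_ineq4)
      also have "\<dots> \<le> inverse (real (Suc n)) * norm d + inverse (real (Suc m)) * norm d"
        by (intro add_mono approx d)
      finally have "norm d * norm d \<le> (inverse (real (Suc m)) + inverse (real (Suc n))) * norm d"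
        by (simp add: distrib_right)
      then show ?thesis
        unfolding d_def[symmetric] by (cases "d = 0") (auto intro: mult_right_le_imp_le simp del: of_nat_Suc)
    qed
    have "Cauchy w"
    proof (rule CauchyI)
      fix e :: real assume "0 < e"
      then obtain N where N: "inverse (real (Suc N)) < e / 2"
        using reals_Archimedean[of "e / 2"] by auto
      have "norm (w m - w n) < e" if mn: "N \<le> m" "N \<le> n" for m n
      proof -
        have "inverse (real (Suc m)) \<le> inverse (real (Suc N))" "inverse (real (Suc n)) \<le> inverse (real (Suc N))"
          using mn by (auto simp: le_imp_inverse_le)
        then show ?thesis
          using cauchy[of m n] N by linarith
      qed
      then show "\<exists>N. \<forall>m\<ge>N. \<forall>n\<ge>N. norm (w m - w n) < e"
        by blast
    qed
    then obtain g where g: "w \<longlonglongrightarrow> g"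
      by (auto simp: Cauchy_convergent_iff convergent_def)
    have orth: "cinner (f - g) v = 0" if v: "v \<in> D" for v
    proof -
      have "(\<lambda>n. inverse (real (Suc n)) * norm v) \<longlonglongrightarrow> 0"
        by (rule tendsto_mult_left_zero[OF LIMSEQ_inverse_real_of_nat])
      then have "(\<lambda>n. cinner (f - w n) v) \<longlonglongrightarrow> 0"
        by (rule LIMSEQ_zero_norm_le) (rule approx[OF v])
      moreover have "(\<lambda>n. cinner (f - w n) v) \<longlonglongrightarrow> cinner (f - g) v"
        by (intro tendsto_intros g)
      ultimately show ?thesis
        using LIMSEQ_unique by blast
    qed
    obtain x k where x: "form_relation V a x k" "(norm x)\<^sup>2 \<le> Re (cinner (f - g) x)" "x = 0 \<Longrightarrow> f - g = 0"
      using form_relation_solvable[OF one_in_S] by blast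
    have "x \<in> D"
      using x(1) by (auto simp: D_def)
    then have "x = 0"
      using x(2) by (simp add: orth)
    then have "f = g"
      using x(3) by simp
    then show ?thesis
      using w g closure_sequential by blast
  qed
  then show ?thesis
    by blast
qed

sublocale accretive_operator D A S
proof
  have \<phi>: "0 < pi / 2 - \<theta>" "pi / 2 - \<theta> \<le> pi / 2"
    using \<theta> by auto
  show "0 \<notin> S"
    using \<phi> by (intro zero_notin_interior_sector) auto
  show "z + w \<in> S" if "z \<in> S" "w \<in> S" for z w
    using \<phi> that by (intro interior_sector_add) auto
  show "complex_of_real t * z \<in> S" if "z \<in> S" "0 < t" for z t
    using that by (intro interior_sector_scale)
  show "\<exists>x\<in>D. x + z *\<^sub>C A x = f" if "z \<in> S" for z f
    using form_relation_solvable[OF that, of f] form_relation_iff by metis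
qed (use operator_in dense_domain one_in_S accretive in auto)

lemma generates_shift:
  "generates_holomorphic_C0_semigroup (pi / 2 - \<theta>) D (\<lambda>x. - (A x + complex_of_real \<gamma> *\<^sub>C x))"
  by (intro generates_holomorphic_C0_semigroup refl sector_subset_insert_interior) (use \<theta> in auto)

end

section \<open>Undoing the shift by \<gamma>\<close>

theorem theorem1p1:
  fixes Da :: "'h::complex_hilbert_space set"
    and a :: "'h \<Rightarrow> 'h \<Rightarrow> complex"
    and \<theta> \<gamma> :: real
  assumes "complex_vector.subspace Da"
    and "closure Da = UNIV"
    and "sesquilinear_on Da a"
    and "0 \<le> \<theta>" and "\<theta> < pi / 2"
    and "\<And>u. u \<in> Da \<Longrightarrow> a u u - complex_of_real (\<gamma> * (norm u)\<^sup>2) \<in> sector \<theta>"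
  shows "\<exists>D A. operator_in D A \<and>
    (\<forall>x f. (x \<in> D \<and> A x = f) \<longleftrightarrow>
       (\<exists>u :: nat \<Rightarrow> 'h. (\<forall>n. u n \<in> Da) \<and>
          bounded (range (\<lambda>n. Re (a (u n) (u n)))) \<and>
          u \<longlonglongrightarrow> x \<and>
          (\<forall>v\<in>Da. (\<lambda>n. a (u n) v) \<longlonglongrightarrow> cinner f v))) \<and>
    generates_holomorphic_C0_semigroup (pi / 2 - \<theta>) D (\<lambda>x. - A x)"
proof -
  define b where "b u v = a u v + complex_of_real (- \<gamma>) * cinner u v" for u v
  interpret b: sectorial_form Da b \<theta>
  proof
    show "sesquilinear_on Da b"
      using assms(3) by (auto simp: sesquilinear_on_def b_def cinner.form_simps algebra_simps)
    show "b u u \<in> sector \<theta>" if "u \<in> Da" for u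
      using assms(6)[OF that] by (simp add: b_def cinner_self)
  qed (use assms in auto)
  define B where "B x = b.A x + complex_of_real \<gamma> *\<^sub>C x" for x
  have "operator_in b.D B"
    using b.operator_in
    by (auto simp: operator_in_def B_def complex_vector.scale_right_distrib mult.commute)
  moreover have "x \<in> b.D \<and> B x = f \<longleftrightarrow> form_relation Da a x f" for x f
  proof -
    have "x \<in> b.D \<and> B x = f \<longleftrightarrow> x \<in> b.D \<and> b.A x = f + complex_of_real (- \<gamma>) *\<^sub>C x"
      by (auto simp: B_def algebra_simps)
    also have "\<dots> \<longleftrightarrow> form_relation Da b x (f + complex_of_real (- \<gamma>) *\<^sub>C x)"
      by (rule b.form_relation_iff)
    also have "\<dots> \<longleftrightarrow> form_relation Da a x f"
    proof
      assume "form_relation Da b x (f + complex_of_real (- \<gamma>) *\<^sub>C x)"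
      from form_relation_shift[OF this, of \<gamma>] show "form_relation Da a x f"
        by (simp add: b_def)
    next
      assume "form_relation Da a x f"
      from form_relation_shift[OF this, of "- \<gamma>"]
      show "form_relation Da b x (f + complex_of_real (- \<gamma>) *\<^sub>C x)"
        by (simp add: b_def[abs_def])
    qed
    finally show ?thesis .
  qed
  moreover have "generates_holomorphic_C0_semigroup (pi / 2 - \<theta>) b.D (\<lambda>x. - B x)"
    unfolding B_def by (rule b.generates_shift)
  ultimately show ?thesis
    unfolding form_relation_def by blast
qed

end
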